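(* For each $n$, let $\beta^*\in\mathbb{R}^p$ have support $\mathcal{S}$ with at most $s$ elements, let $x_1,\dots,x_n\in\mathbb{R}^p$ be fixed vectors with $\sum_{i=1}^n(x_i)_j^2\le n$ for all $j\in\{1,\dots,p\}$, and let $Y_1,\dots,Y_n$ be independent Bernoulli random variables with $$\mathsf{P}\{Y_i=1\}=1-\mathsf{P}\{Y_i=0\}=\frac1{1+\exp(-\langle x_i,\beta^*\rangle)} .$$ Let $$L_n(\beta)=\frac1n\sum_{i=1}^n\ln\left\{1+\exp\left[-(2Y_i-1)\langle x_i,\beta\rangle\right]\right\},\qquad \hat\beta_n:=\arg\min_{\beta\in\mathbb{R}^p}L_n(\beta)+\tau_n\|\beta\|_1,\quad\tau_n>0,$$ and let $\nu_n:=\max_i\|(x_i)_{\mathcal{S}}\|_2$ and $\gamma_n:=\max_i\|x_i\|_\infty$. Suppose that, for some $\lambda_{\min}>0$ and $\alpha\in(0,1]$ bounded away from zero, the following hold: (i) $[\nabla^2L_n(\beta^* )]_{\mathcal{S},\mathcal{S}}\ge\lambda_{\min}I$ in the positive-semidefinite order; (ii) $\left\|[\nabla^2L_n(\beta^* )]_{\mathcal{S}^c,\mathcal{S}}[\nabla^2L_n(\beta^* )]_{\mathcal{S},\mathcal{S}}^{-1}\right\|_\infty<1-\alpha$; (iii) $\min\{|(\beta^* )_k|:k\in\mathcal{S}\}>\frac{\alpha+4}{\lambda_{\min}}\sqrt s\,\tau_n$. If $\tau_n$ is chosen such that $\tau_n\gg(n^{-1}\log p)^{1/2}$, and $s$ and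 $p$ are such that $s^2(\log p)\,\nu_n^4\gamma_n^2\ll n$, then the $\ell_1$-regularized maximum-likelihood estimator $\hat\beta_n$ is sparsistent, i.e. $\lim_{n\to\infty}\mathsf{P}\{\mathrm{supp}\,\hat\beta_n\neq\mathrm{supp}\,\beta^*\}=0$.
   Context: High-dimensional setting: $p$, $s$, $\beta^*$, the $x_i$ and $\tau_n$ may all vary with $n$. For sequences, $a_n\ll b_n$ (equivalently $b_n\gg a_n$) means $a_n/b_n\to0$ as $n\to\infty$. $\mathrm{supp}\,v$ is the set of indices of non-zero entries of $v$; $v_{\mathcal{S}}$ is the sub-vector of $v$ on $\mathcal{S}$; $A_{\mathcal{S},\mathcal{S}}$ and $A_{\mathcal{S}^c,\mathcal{S}}$ are the sub-matrices with rows and columns indexed by $\mathcal{S}$ and its complement $\mathcal{S}^c$ in $\{1,\dots,p\}$ as indicated; for a matrix, $\|\cdot\|_\infty$ is the operator norm induced by the vector $\ell_\infty$-norm (maximum absolute row sum). The Hessian $\nabla^2L_n(\beta^* )$ does not depend on the $Y_i$, so (i) and (ii) are deterministic conditions.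
   Formalization: Two conditions are added, since the claim fails without them: τ_n ≪ 1/(s ν_n² γ_n), because a constant τ_n allowed by (iii) can break support recovery, and p ≥ 2, because for p = 1 log p = 0 puts no lower bound on τ_n. *)

theory Defs
  imports "HOL-Probability.Probability"
begin

text \<open>
  The dimension \<open>p\<close> varies with \<open>n\<close>, so a vector in \<open>\<real>\<^sup>p\<close> is a function \<open>nat \<Rightarrow> real\<close> of which only
  the values on \<open>{1..p}\<close> are ever used, and a matrix is a function \<open>nat \<Rightarrow> nat \<Rightarrow> real\<close>.  A
  sub-matrix is not reindexed: the sets of its row and column indices are passed explicitly to
  each matrix operation.
\<close>

definition supp_vec :: "nat \<Rightarrow> (nat \<Rightarrow> real) \<Rightarrow> nat set" where
  "supp_vec p v = {j \<in> {1..p}. v j \<noteq> 0}"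

definition inner_vec :: "nat \<Rightarrow> (nat \<Rightarrow> real) \<Rightarrow> (nat \<Rightarrow> real) \<Rightarrow> real" where
  "inner_vec p u v = (\<Sum>j = 1..p. u j * v j)"

definition l1_norm :: "nat \<Rightarrow> (nat \<Rightarrow> real) \<Rightarrow> real" where
  "l1_norm p v = (\<Sum>j = 1..p. \<bar>v j\<bar>)"

definition linf_norm :: "nat \<Rightarrow> (nat \<Rightarrow> real) \<Rightarrow> real" where
  "linf_norm p v = Max ((\<lambda>j. \<bar>v j\<bar>) ` {1..p})"


definition partial_deriv :: "nat \<Rightarrow> ((nat \<Rightarrow> real) \<Rightarrow> real) \<Rightarrow> (nat \<Rightarrow> real) \<Rightarrow> real" where
  "partial_deriv j f \<beta> = deriv (\<lambda>t. f (\<beta>(j := t))) (\<beta> j)"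

definition hessian :: "((nat \<Rightarrow> real) \<Rightarrow> real) \<Rightarrow> (nat \<Rightarrow> real) \<Rightarrow> nat \<Rightarrow> nat \<Rightarrow> real" where
  "hessian f \<beta> j k = partial_deriv j (partial_deriv k f) \<beta>"


definition id_mat :: "nat \<Rightarrow> nat \<Rightarrow> real" where
  "id_mat j k = (if j = k then 1 else 0)"

definition mult_mat :: "nat set \<Rightarrow> (nat \<Rightarrow> nat \<Rightarrow> real) \<Rightarrow> (nat \<Rightarrow> nat \<Rightarrow> real) \<Rightarrow> nat \<Rightarrow> nat \<Rightarrow> real" where
  "mult_mat K A B i j = (\<Sum>k\<in>K. A i k * B k j)"

text \<open>
  The inverse of the square sub-matrix of \<open>A\<close> on \<open>S \<times> S\<close>.  As for \<open>matrix_inv\<close> in HOL-Analysis,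
  the choice is meaningful only if that sub-matrix is invertible; its entries on \<open>S \<times> S\<close> are then
  uniquely determined.
\<close>

definition inv_mat :: "nat set \<Rightarrow> (nat \<Rightarrow> nat \<Rightarrow> real) \<Rightarrow> nat \<Rightarrow> nat \<Rightarrow> real" where
  "inv_mat S A = (SOME B. \<forall>i\<in>S. \<forall>j\<in>S.
     mult_mat S A B i j = id_mat i j \<and> mult_mat S B A i j = id_mat i j)"

definition pos_semidef :: "nat set \<Rightarrow> (nat \<Rightarrow> nat \<Rightarrow> real) \<Rightarrow> bool" where
  "pos_semidef S A \<longleftrightarrow>
     (\<forall>j\<in>S. \<forall>k\<in>S. A j k = A k j) \<and>
     (\<forall>v :: nat \<Rightarrow> real. (\<Sum>j\<in>S. \<Sum>k\<in>S. v j * A j k * v k) \<ge> 0)"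

definition loewner_ge :: "nat set \<Rightarrow> (nat \<Rightarrow> nat \<Rightarrow> real) \<Rightarrow> (nat \<Rightarrow> nat \<Rightarrow> real) \<Rightarrow> bool" where
  "loewner_ge S A B \<longleftrightarrow> pos_semidef S (\<lambda>j k. A j k - B j k)"

text \<open>
  Maximum absolute row sum over the rows \<open>R\<close> and columns \<open>C\<close>; inserting \<open>0\<close> only fixes the norm of
  a matrix without rows.
\<close>

definition linf_op_norm :: "nat set \<Rightarrow> nat set \<Rightarrow> (nat \<Rightarrow> nat \<Rightarrow> real) \<Rightarrow> real" where
  "linf_op_norm R C A = Max (insert 0 ((\<lambda>i. \<Sum>j\<in>C. \<bar>A i j\<bar>) ` R))"


text \<open>\<open>x i\<close> is the \<open>i\<close>-th design vector and \<open>y i\<close> the \<open>i\<close>-th label, which is \<open>0\<close> or \<open>1\<close>.\<close>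

definition logistic_loss ::
    "nat \<Rightarrow> nat \<Rightarrow> (nat \<Rightarrow> nat \<Rightarrow> real) \<Rightarrow> (nat \<Rightarrow> real) \<Rightarrow> (nat \<Rightarrow> real) \<Rightarrow> real" where
  "logistic_loss n p x y \<beta> =
     (1 / real n) * (\<Sum>i = 1..n. ln (1 + exp (- ((2 * y i - 1) * inner_vec p (x i) \<beta>))))"

text \<open>The quantities \<open>\<nu>\<^sub>n\<close> and \<open>\<gamma>\<^sub>n\<close>.\<close>

definition max_l2_on :: "nat \<Rightarrow> nat set \<Rightarrow> (nat \<Rightarrow> nat \<Rightarrow> real) \<Rightarrow> real" where
  "max_l2_on n S x = Max ((\<lambda>i. L2_set (x i) S) ` {1..n})"

definition max_linf :: "nat \<Rightarrow> nat \<Rightarrow> (nat \<Rightarrow> nat \<Rightarrow> real) \<Rightarrow> real" where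
  "max_linf n p x = Max ((\<lambda>i. linf_norm p (x i)) ` {1..n})"


definition much_less :: "(nat \<Rightarrow> real) \<Rightarrow> (nat \<Rightarrow> real) \<Rightarrow> bool" (infix \<open>\<lless>\<close> 50) where
  "a \<lless> b \<longleftrightarrow> (\<lambda>n. a n / b n) \<longlonglongrightarrow> 0"

end

theory Submission
  imports Defs
begin

text \<open>
  The proof is a primal-dual witness argument.  Consider the gradient \<open>W\<close> of the loss at the true
  parameter, a weighted sum of centred Bernoulli variables.  Hoeffding's inequality and a union bound
  over the \<open>p\<close> coordinates show that \<open>\<bar>W j\<bar> \<le> \<delta> * \<tau>\<close> for all \<open>j\<close>, for any fixed \<open>\<delta> > 0\<close>, with
  probability tending to one, because \<open>n * \<tau>\<^sup>2\<close> dominates \<open>ln p\<close> (\<open>logistic_score_tail\<close>,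
  \<open>union_bound_exponential\<close>).  What remains is deterministic.

  Restricted to vectors supported in \<open>S\<close>, the Hessian at the truth is at least \<open>lam\<close>, so the
  penalised loss on such vectors has a stationary point at distance less than
  \<open>r = (\<alpha> + 4) / lam * sqrt s * \<tau>\<close> from the truth.  The minimal signal strength exceeds \<open>r\<close>, so this point has the true signs.  Its optimality conditions on \<open>S\<close> say that the
  loss gradient there equals \<open>- \<tau> * sgn\<close>; after linearisation, the Hessian block on \<open>S\<close> maps the
  displacement to a vector with entries close to \<open>\<plusminus> \<tau>\<close>.  The irrepresentability condition
  then bounds the gradient outside \<open>S\<close> by nearly \<open>(1 - \<alpha>) * \<tau>\<close>, hence strictly by \<open>\<tau>\<close>.  Such a strict
  dual certificate forces every minimiser to vanish outside \<open>S\<close> (\<open>l1_dual_certificate\<close>), and a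
  convexity argument keeps the minimiser within distance \<open>r\<close> of the truth, so that no coordinate of
  \<open>S\<close> is lost (\<open>logistic_lasso_support\<close>).

  Both linearisation errors, the quadratic one in the gradient and the cubic one in the loss, are
  small relative to \<open>\<tau>\<close> and \<open>r\<^sup>2\<close> as soon as \<open>s * \<nu>\<^sup>2 * \<gamma> * \<tau>\<close> is small
  (\<open>logistic_lasso_support_rate\<close>), and this quantity tends to zero by the upper bound on \<open>\<tau>\<close>.
\<close>

section \<open>The softplus and sigmoid functions\<close>

definition softplus :: "real \<Rightarrow> real" where
  "softplus z = ln (1 + exp z)"

definition sigmoid :: "real \<Rightarrow> real" where
  "sigmoid z = 1 / (1 + exp (- z))"

definition sigmoid' :: "real \<Rightarrow> real" where
  "sigmoid' z = sigmoid z * (1 - sigmoid z)"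

lemma sigmoid_bounds: "0 < sigmoid z" "sigmoid z < 1"
  by (simp_all add: sigmoid_def divide_simps add_pos_pos)

lemma sigmoid'_nonneg: "0 \<le> sigmoid' z"
  using sigmoid_bounds[of z] by (simp add: sigmoid'_def)

lemma DERIV_softplus: "(softplus has_real_derivative sigmoid z) (at z)"
proof -
  have "((\<lambda>z. ln (1 + exp z)) has_real_derivative exp z / (1 + exp z)) (at z)"
    by (auto intro!: derivative_eq_intros simp: add_pos_pos)
  moreover have "exp z / (1 + exp z) = sigmoid z"
    by (simp add: sigmoid_def exp_minus field_simps add_pos_pos)
  ultimately show ?thesis
    by (simp add: softplus_def[abs_def])
qed

lemma DERIV_sigmoid: "(sigmoid has_real_derivative sigmoid' z) (at z)"
proof -
  have nz: "1 + exp (- z) \<noteq> 0" "exp (- z) + 1 \<noteq> 0"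
    using exp_gt_zero[of "- z"] by linarith+
  have "((\<lambda>z. 1 / (1 + exp (- z))) has_real_derivative exp (- z) / (1 + exp (- z))\<^sup>2) (at z)"
    using nz by (auto intro!: derivative_eq_intros simp: power2_eq_square)
  moreover have "exp (- z) / (1 + exp (- z))\<^sup>2 = sigmoid' z"
    using nz by (simp add: sigmoid'_def sigmoid_def field_simps power2_eq_square)
  ultimately show ?thesis
    by (simp add: sigmoid_def[abs_def])
qed

lemma DERIV_sigmoid':
  "(sigmoid' has_real_derivative sigmoid' z * (1 - 2 * sigmoid z)) (at z)"
  unfolding sigmoid'_def[abs_def]
  by (rule derivative_eq_intros DERIV_sigmoid refl)+ (simp add: sigmoid'_def algebra_simps)

lemma abs_sigmoid''_le_1: "\<bar>sigmoid' z * (1 - 2 * sigmoid z)\<bar> \<le> 1"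
proof -
  have "\<bar>sigmoid' z\<bar> \<le> 1 * 1"
    unfolding sigmoid'_def abs_mult using sigmoid_bounds[of z] by (intro mult_mono) auto
  moreover have "\<bar>1 - 2 * sigmoid z\<bar> \<le> 1"
    using sigmoid_bounds[of z] by auto
  ultimately show ?thesis
    unfolding abs_mult using mult_mono[of "\<bar>sigmoid' z\<bar>" 1 "\<bar>1 - 2 * sigmoid z\<bar>" 1] by simp
qed

lemma convex_softplus: "convex_on UNIV softplus"
  using DERIV_softplus DERIV_sigmoid sigmoid'_nonneg by (intro f''_ge0_imp_convex) auto

lemma softplus_above_tangent: "softplus z + sigmoid z * (w - z) \<le> softplus w"
  using convex_on_imp_above_tangent[OF convex_softplus, of z w "sigmoid z"] DERIV_softplus[of z]
  by simp

text \<open>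
  Both Taylor estimates rest on \<open>\<bar>sigmoid''\<bar> \<le> 1\<close>.  Because this bound does not depend on the
  expansion point, the two remainders depend only on the size of the increment.
\<close>

lemma sigmoid_linear_approx: "\<bar>sigmoid (z + h) - sigmoid z - sigmoid' z * h\<bar> \<le> h\<^sup>2 / 2"
proof -
  define d where "d m = (if m = 0 then (\<lambda>h. sigmoid (z + h)) else if m = 1 then (\<lambda>h. sigmoid' (z + h))
     else (\<lambda>h. sigmoid' (z + h) * (1 - 2 * sigmoid (z + h))))" for m :: nat
  have "DERIV (d m) t :> d (Suc m) t" if "m < 2" for m t
  proof -
    have "m = 0 \<or> m = 1" using that by auto
    then show ?thesis
      using DERIV_sigmoid[of "z + t"] DERIV_sigmoid'[of "z + t"]
      by (auto simp: d_def DERIV_shift add.commute)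
  qed
  then obtain t where "sigmoid (z + h) = (\<Sum>m<2. d m 0 / fact m * h ^ m) + d 2 t / fact 2 * h ^ 2"
    using Maclaurin_bi_le[of d "\<lambda>h. sigmoid (z + h)" 2 h] by (auto simp: d_def)
  then have "sigmoid (z + h) - sigmoid z - sigmoid' z * h = d 2 t * (h\<^sup>2 / 2)"
    by (simp add: d_def lessThan_Suc numeral_2_eq_2)
  moreover have "\<bar>d 2 t\<bar> \<le> 1"
    using abs_sigmoid''_le_1 by (simp add: d_def)
  then have "\<bar>d 2 t * (h\<^sup>2 / 2)\<bar> \<le> h\<^sup>2 / 2"
    using mult_right_mono[of "\<bar>d 2 t\<bar>" 1 "h\<^sup>2 / 2"] by (simp add: abs_mult)
  ultimately show ?thesis
    by metis
qed

lemma softplus_quadratic_lower: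
  "softplus z + sigmoid z * h + sigmoid' z * h\<^sup>2 / 2 - \<bar>h\<bar> ^ 3 / 6 \<le> softplus (z + h)"
proof -
  define d where "d m = (if m = 0 then (\<lambda>h. softplus (z + h)) else if m = 1 then (\<lambda>h. sigmoid (z + h))
     else if m = 2 then (\<lambda>h. sigmoid' (z + h))
     else (\<lambda>h. sigmoid' (z + h) * (1 - 2 * sigmoid (z + h))))" for m :: nat
  have "DERIV (d m) t :> d (Suc m) t" if "m < 3" for m t
  proof -
    have "m = 0 \<or> m = 1 \<or> m = 2" using that by auto
    then show ?thesis
      using DERIV_softplus[of "z + t"] DERIV_sigmoid[of "z + t"] DERIV_sigmoid'[of "z + t"]
      by (auto simp: d_def DERIV_shift add.commute)
  qed
  then obtain t where "softplus (z + h) = (\<Sum>m<3. d m 0 / fact m * h ^ m) + d 3 t / fact 3 * h ^ 3"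
    using Maclaurin_bi_le[of d "\<lambda>h. softplus (z + h)" 3 h] by (auto simp: d_def)
  then have "softplus (z + h) = softplus z + sigmoid z * h + sigmoid' z * h\<^sup>2 / 2 + d 3 t * (h ^ 3 / 6)"
    by (simp add: d_def lessThan_Suc eval_nat_numeral)
  moreover have "\<bar>d 3 t * (h ^ 3 / 6)\<bar> \<le> \<bar>h\<bar> ^ 3 / 6"
    using abs_sigmoid''_le_1[of "z + t"] mult_right_mono[of "\<bar>d 3 t\<bar>" 1 "\<bar>h\<bar> ^ 3 / 6"]
    by (simp add: abs_mult power_abs d_def)
  ultimately show ?thesis
    by linarith
qed

section \<open>Derivatives and Taylor bounds of the logistic loss\<close>

definition loss_grad where
  "loss_grad n p x y \<beta> j = (1 / real n) * (\<Sum>i = 1..n. x i j * (sigmoid (inner_vec p (x i) \<beta>) - y i))"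
  for n p :: nat and x :: "nat \<Rightarrow> nat \<Rightarrow> real" and y \<beta> :: "nat \<Rightarrow> real" and j :: nat

definition loss_hess where
  "loss_hess n p x \<beta> j k = (1 / real n) * (\<Sum>i = 1..n. x i j * x i k * sigmoid' (inner_vec p (x i) \<beta>))"
  for n p :: nat and x :: "nat \<Rightarrow> nat \<Rightarrow> real" and \<beta> :: "nat \<Rightarrow> real" and j k :: nat

text \<open>
  For labels in \<open>{0, 1}\<close> the loss is a softplus minus a term linear in the labels.  Hence the labels
  survive in the gradient and drop out of all higher derivatives.
\<close>

lemma logistic_loss_softplus:
  assumes "y \<in> {1..n} \<rightarrow> {0, 1}"
  shows "logistic_loss n p x y \<beta>
    = (1 / real n) * (\<Sum>i = 1..n. softplus (inner_vec p (x i) \<beta>) - y i * inner_vec p (x i) \<beta>)"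
proof -
  have "ln (1 + exp (- ((2 * y i - 1) * z))) = softplus z - y i * z" if "i \<in> {1..n}" for i z
  proof -
    have "y i = 0 \<or> y i = 1" using assms that by auto
    moreover have "1 + exp (- z) = (1 + exp z) / exp z"
      by (simp add: exp_minus add_divide_distrib inverse_eq_divide)
    moreover have "1 + exp z \<noteq> 0"
      using exp_gt_zero[of z] by linarith
    ultimately have "ln (1 + exp (- z)) = ln (1 + exp z) - z" "y i = 0 \<or> y i = 1"
      by (simp_all add: ln_div)
    then show ?thesis
      by (auto simp: softplus_def)
  qed
  then show ?thesis
    unfolding logistic_loss_def by (intro arg_cong2[where f = "(*)"] refl sum.cong) auto
qed

lemma inner_vec_cong:
  "(\<And>j. j \<in> {1..p} \<Longrightarrow> a j = b j) \<Longrightarrow> inner_vec p v a = inner_vec p v b"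
  by (auto simp: inner_vec_def intro: sum.cong)

lemma inner_vec_add: "inner_vec p v (\<lambda>j. a j + b j) = inner_vec p v a + inner_vec p v b"
  by (simp add: inner_vec_def algebra_simps sum.distrib)

lemma inner_vec_diff: "inner_vec p v (\<lambda>j. a j - b j) = inner_vec p v a - inner_vec p v b"
  by (simp add: inner_vec_def algebra_simps sum_subtractf)

lemma inner_vec_supported:
  assumes "S \<subseteq> {1..p}" "\<And>j. j \<notin> S \<Longrightarrow> d j = 0"
  shows "inner_vec p v d = (\<Sum>j\<in>S. v j * d j)"
  unfolding inner_vec_def by (rule sum.mono_neutral_right) (use assms in auto)

lemma inner_vec_upd:
  assumes "j \<in> {1..p}"
  shows "inner_vec p v (\<beta>(j := t)) = inner_vec p v \<beta> + v j * (t - \<beta> j)"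
proof -
  have "inner_vec p v (\<beta>(j := t)) - inner_vec p v \<beta> = (\<Sum>k = 1..p. if k = j then v j * (t - \<beta> j) else 0)"
    unfolding inner_vec_def sum_subtractf[symmetric] by (rule sum.cong) (auto simp: algebra_simps)
  then show ?thesis
    using assms by simp
qed

lemma DERIV_logistic_loss:
  assumes "y \<in> {1..n} \<rightarrow> {0, 1}" "j \<in> {1..p}"
  shows "((\<lambda>t. logistic_loss n p x y (\<beta>(j := t))) has_real_derivative loss_grad n p x y \<beta> j) (at (\<beta> j))"
  unfolding logistic_loss_softplus[OF assms(1)] inner_vec_upd[OF assms(2)] loss_grad_def
proof (rule DERIV_cmult, rule DERIV_sum)
  fix i
  let ?z = "inner_vec p (x i) \<beta>"
  have lin: "((\<lambda>t. ?z + x i j * (t - \<beta> j)) has_real_derivative x i j) (at (\<beta> j))"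
    by (auto intro!: derivative_eq_intros)
  have "((\<lambda>t. softplus (?z + x i j * (t - \<beta> j))) has_real_derivative sigmoid ?z * x i j) (at (\<beta> j))"
    using DERIV_chain2[OF DERIV_softplus lin] by simp
  from DERIV_diff[OF this DERIV_cmult[OF lin, of "y i"]]
  show "((\<lambda>t. softplus (?z + x i j * (t - \<beta> j)) - y i * (?z + x i j * (t - \<beta> j)))
      has_real_derivative x i j * (sigmoid ?z - y i)) (at (\<beta> j))"
    by (simp add: algebra_simps)
qed

lemma DERIV_loss_grad:
  assumes "j \<in> {1..p}"
  shows "((\<lambda>t. loss_grad n p x y (\<beta>(j := t)) k) has_real_derivative loss_hess n p x \<beta> j k) (at (\<beta> j))"
  unfolding loss_grad_def inner_vec_upd[OF assms] loss_hess_def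
proof (rule DERIV_cmult, rule DERIV_sum)
  fix i
  let ?z = "inner_vec p (x i) \<beta>"
  have lin: "((\<lambda>t. ?z + x i j * (t - \<beta> j)) has_real_derivative x i j) (at (\<beta> j))"
    by (auto intro!: derivative_eq_intros)
  have "((\<lambda>t. sigmoid (?z + x i j * (t - \<beta> j))) has_real_derivative sigmoid' ?z * x i j) (at (\<beta> j))"
    using DERIV_chain2[OF DERIV_sigmoid lin] by simp
  from DERIV_cmult[OF DERIV_diff[OF this DERIV_const[of "y i"]], of "x i k"]
  show "((\<lambda>t. x i k * (sigmoid (?z + x i j * (t - \<beta> j)) - y i))
      has_real_derivative x i j * x i k * sigmoid' ?z) (at (\<beta> j))"
    by (simp add: algebra_simps)
qed

lemma hessian_logistic_loss:
  assumes "y \<in> {1..n} \<rightarrow> {0, 1}" "j \<in> {1..p}" "k \<in> {1..p}"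
  shows "hessian (logistic_loss n p x y) \<beta> j k = loss_hess n p x \<beta> j k"
proof -
  have "partial_deriv k (logistic_loss n p x y) = (\<lambda>b. loss_grad n p x y b k)"
    by (rule ext) (simp add: partial_deriv_def DERIV_imp_deriv[OF DERIV_logistic_loss[OF assms(1,3)]])
  then show ?thesis
    using DERIV_loss_grad[OF assms(2)] by (simp add: hessian_def partial_deriv_def DERIV_imp_deriv)
qed

lemma sum_grad_inner:
  "(\<Sum>j = 1..p. loss_grad n p x y \<beta> j * d j)
    = (1 / real n) * (\<Sum>i = 1..n. (sigmoid (inner_vec p (x i) \<beta>) - y i) * inner_vec p (x i) d)"
proof -
  have "(\<Sum>j = 1..p. loss_grad n p x y \<beta> j * d j)
      = (1 / real n) * (\<Sum>j = 1..p. \<Sum>i = 1..n. (sigmoid (inner_vec p (x i) \<beta>) - y i) * (x i j * d j))"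
    unfolding loss_grad_def sum_distrib_left sum_distrib_right
    by (intro sum.cong refl) (simp add: algebra_simps)
  also have "\<dots> = (1 / real n) * (\<Sum>i = 1..n. \<Sum>j = 1..p. (sigmoid (inner_vec p (x i) \<beta>) - y i) * (x i j * d j))"
    by (subst sum.swap) simp
  finally show ?thesis
    by (simp add: inner_vec_def sum_distrib_left)
qed

lemma logistic_loss_above_tangent:
  assumes "y \<in> {1..n} \<rightarrow> {0, 1}"
  shows "logistic_loss n p x y a + (\<Sum>j = 1..p. loss_grad n p x y a j * (b j - a j))
    \<le> logistic_loss n p x y b"
  unfolding sum_grad_inner logistic_loss_softplus[OF assms] inner_vec_diff distrib_left[symmetric]
    sum.distrib[symmetric]
proof (intro mult_left_mono sum_mono)
  fix i
  show "softplus (inner_vec p (x i) a) - y i * inner_vec p (x i) a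
      + (sigmoid (inner_vec p (x i) a) - y i) * (inner_vec p (x i) b - inner_vec p (x i) a)
    \<le> softplus (inner_vec p (x i) b) - y i * inner_vec p (x i) b"
    using softplus_above_tangent[of "inner_vec p (x i) a" "inner_vec p (x i) b"]
    by (simp add: algebra_simps)
qed simp

text \<open>
  A lower bound that keeps the exact Hessian at \<open>\<beta>\<close>.  Convexity alone would not give the quadratic
  growth that keeps a minimiser close to \<open>\<beta>\<close>; the price is a cubic error in the largest change
  \<open>h\<close> of a linear predictor.
\<close>

lemma logistic_loss_quadratic_lower:
  assumes y: "y \<in> {1..n} \<rightarrow> {0, 1}" and S: "S \<subseteq> {1..p}" and d: "\<And>j. j \<notin> S \<Longrightarrow> d j = 0"
    and n: "n \<ge> 1" and h: "\<And>i. i \<in> {1..n} \<Longrightarrow> \<bar>inner_vec p (x i) d\<bar> \<le> h"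
  shows "logistic_loss n p x y \<beta> + (\<Sum>j\<in>S. loss_grad n p x y \<beta> j * d j)
      + (\<Sum>j\<in>S. \<Sum>k\<in>S. d j * loss_hess n p x \<beta> j k * d k) / 2 - h ^ 3 / 6
    \<le> logistic_loss n p x y (\<lambda>j. \<beta> j + d j)"
proof -
  let ?z = "\<lambda>i. inner_vec p (x i) \<beta>" and ?h = "\<lambda>i. inner_vec p (x i) d"
  have grad: "(\<Sum>j\<in>S. loss_grad n p x y \<beta> j * d j) = (1 / real n) * (\<Sum>i = 1..n. (sigmoid (?z i) - y i) * ?h i)"
    unfolding sum_grad_inner[symmetric] by (rule sum.mono_neutral_left) (use S d in auto)
  have "(\<Sum>j\<in>S. \<Sum>k\<in>S. d j * loss_hess n p x \<beta> j k * d k)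
      = (1 / real n) * (\<Sum>j\<in>S. \<Sum>k\<in>S. \<Sum>i = 1..n. sigmoid' (?z i) * ((x i j * d j) * (x i k * d k)))"
    unfolding loss_hess_def sum_distrib_left sum_distrib_right
    by (intro sum.cong refl) (simp add: algebra_simps)
  also have "\<dots> = (1 / real n) * (\<Sum>i = 1..n. \<Sum>j\<in>S. \<Sum>k\<in>S. sigmoid' (?z i) * ((x i j * d j) * (x i k * d k)))"
    by (simp only: sum.swap[of _ "{1..n}"])
  also have "\<dots> = (1 / real n) * (\<Sum>i = 1..n. sigmoid' (?z i) * (?h i)\<^sup>2)"
  proof -
    have "(?h i)\<^sup>2 = (\<Sum>j\<in>S. \<Sum>k\<in>S. (x i j * d j) * (x i k * d k))" for i
      using inner_vec_supported[of S p d "x i", OF S d] by (simp add: power2_eq_square sum_product)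
    then show ?thesis
      by (simp only: sum_distrib_left)
  qed
  finally have hess: "(\<Sum>j\<in>S. \<Sum>k\<in>S. d j * loss_hess n p x \<beta> j k * d k)
    = (1 / real n) * (\<Sum>i = 1..n. sigmoid' (?z i) * (?h i)\<^sup>2)" .
  have const: "h ^ 3 / 6 = (1 / real n) * (\<Sum>i = 1..n. h ^ 3 / 6)"
    using n by simp
  have "logistic_loss n p x y \<beta> + (\<Sum>j\<in>S. loss_grad n p x y \<beta> j * d j)
      + (\<Sum>j\<in>S. \<Sum>k\<in>S. d j * loss_hess n p x \<beta> j k * d k) / 2 - h ^ 3 / 6
    = (1 / real n) * (\<Sum>i = 1..n. softplus (?z i) - y i * ?z i + (sigmoid (?z i) - y i) * ?h i
        + sigmoid' (?z i) * (?h i)\<^sup>2 / 2 - h ^ 3 / 6)"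
    unfolding grad hess logistic_loss_softplus[OF y] 
    by (subst const) (simp only: sum.distrib sum_subtractf distrib_left right_diff_distrib
        sum_divide_distrib[symmetric] times_divide_eq_right)
  also have "\<dots> \<le> (1 / real n) * (\<Sum>i = 1..n. softplus (?z i + ?h i) - y i * (?z i + ?h i))"
  proof (intro mult_left_mono sum_mono)
    fix i assume i: "i \<in> {1..n}"
    have "\<bar>?h i\<bar> ^ 3 \<le> h ^ 3"
      using h[OF i] by (intro power_mono) auto
    then show "softplus (?z i) - y i * ?z i + (sigmoid (?z i) - y i) * ?h i
        + sigmoid' (?z i) * (?h i)\<^sup>2 / 2 - h ^ 3 / 6 \<le> softplus (?z i + ?h i) - y i * (?z i + ?h i)"
      using softplus_quadratic_lower[of "?z i" "?h i"] by (simp add: algebra_simps)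
  qed simp
  finally show ?thesis
    by (simp add: logistic_loss_softplus[OF y] inner_vec_add)
qed

text \<open>
  The gradient near \<open>\<beta>\<close> is the gradient at \<open>\<beta>\<close> plus the Hessian applied to the increment, up to an
  error quadratic in \<open>h\<close>.  Coordinates \<open>j\<close> outside \<open>S\<close> are included, since dual feasibility is a
  statement about exactly those.
\<close>

lemma loss_grad_linear_approx:
  assumes S: "S \<subseteq> {1..p}" and d: "\<And>j. j \<notin> S \<Longrightarrow> d j = 0" and n: "n \<ge> 1"
    and h: "\<And>i. i \<in> {1..n} \<Longrightarrow> \<bar>inner_vec p (x i) d\<bar> \<le> h"
    and g: "\<And>i. i \<in> {1..n} \<Longrightarrow> \<bar>x i j\<bar> \<le> g"
  shows "\<bar>loss_grad n p x y (\<lambda>j. \<beta> j + d j) j - loss_grad n p x y \<beta> j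
      - (\<Sum>k\<in>S. loss_hess n p x \<beta> j k * d k)\<bar> \<le> g * h\<^sup>2 / 2"
proof -
  let ?z = "\<lambda>i. inner_vec p (x i) \<beta>" and ?h = "\<lambda>i. inner_vec p (x i) d"
  let ?e = "\<lambda>i. x i j * (sigmoid (?z i + ?h i) - sigmoid (?z i) - sigmoid' (?z i) * ?h i)"
  have "(\<Sum>k\<in>S. loss_hess n p x \<beta> j k * d k)
      = (1 / real n) * (\<Sum>k\<in>S. \<Sum>i = 1..n. x i j * sigmoid' (?z i) * (x i k * d k))"
    unfolding loss_hess_def sum_distrib_left sum_distrib_right
    by (intro sum.cong refl) (simp add: algebra_simps)
  also have "\<dots> = (1 / real n) * (\<Sum>i = 1..n. x i j * (sigmoid' (?z i) * ?h i))"
    by (subst sum.swap) (simp add: inner_vec_supported[OF S d] sum_distrib_left mult.assoc)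
  finally have "loss_grad n p x y (\<lambda>j. \<beta> j + d j) j - loss_grad n p x y \<beta> j
      - (\<Sum>k\<in>S. loss_hess n p x \<beta> j k * d k) = (1 / real n) * (\<Sum>i = 1..n. ?e i)"
    by (simp only: loss_grad_def inner_vec_add right_diff_distrib[symmetric] sum_subtractf[symmetric])
       (intro arg_cong2[where f = "(*)"] refl sum.cong, simp add: algebra_simps)
  moreover have "\<bar>\<Sum>i = 1..n. ?e i\<bar> \<le> (\<Sum>i = 1..n. g * h\<^sup>2 / 2)"
  proof (rule order_trans[OF sum_abs], rule sum_mono)
    fix i assume i: "i \<in> {1..n}"
    have "(?h i)\<^sup>2 \<le> h\<^sup>2"
      using h[OF i] power_mono[of "\<bar>?h i\<bar>" h 2] by simp
    then have "\<bar>?e i\<bar> \<le> g * (h\<^sup>2 / 2)"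
      unfolding abs_mult using sigmoid_linear_approx[of "?z i" "?h i"] g[OF i]
      by (intro mult_mono) auto
    then show "\<bar>?e i\<bar> \<le> g * h\<^sup>2 / 2" by simp
  qed
  then have "\<bar>(1 / real n) * (\<Sum>i = 1..n. ?e i)\<bar> \<le> g * h\<^sup>2 / 2"
    using n by (simp add: abs_mult divide_simps mult.commute)
  ultimately show ?thesis
    by metis
qed

lemma logistic_loss_segment:
  assumes "y \<in> {1..n} \<rightarrow> {0, 1}" "0 \<le> t" "t \<le> 1"
  shows "logistic_loss n p x y (\<lambda>j. b j + t * d j)
    \<le> (1 - t) * logistic_loss n p x y b + t * logistic_loss n p x y (\<lambda>j. b j + d j)"
proof -
  have cvx: "softplus (z + t * w) \<le> (1 - t) * softplus z + t * softplus (z + w)" for z w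
    using convex_onD[OF convex_softplus, of t z "z + w"] assms by (simp add: algebra_simps)
  have scale: "inner_vec p v (\<lambda>j. t * d j) = t * inner_vec p v d" for v
    by (simp add: inner_vec_def sum_distrib_left algebra_simps)
  have "softplus (inner_vec p (x i) (\<lambda>j. b j + t * d j)) - y i * inner_vec p (x i) (\<lambda>j. b j + t * d j)
     \<le> (1 - t) * (softplus (inner_vec p (x i) b) - y i * inner_vec p (x i) b)
       + t * (softplus (inner_vec p (x i) (\<lambda>j. b j + d j)) - y i * inner_vec p (x i) (\<lambda>j. b j + d j))" for i
    unfolding inner_vec_add scale
    using cvx[of "inner_vec p (x i) b" "inner_vec p (x i) d"]
    by (simp add: algebra_simps)
  then have "(\<Sum>i = 1..n. softplus (inner_vec p (x i) (\<lambda>j. b j + t * d j)) - y i * inner_vec p (x i) (\<lambda>j. b j + t * d j))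
     \<le> (\<Sum>i = 1..n. (1 - t) * (softplus (inner_vec p (x i) b) - y i * inner_vec p (x i) b)
       + t * (softplus (inner_vec p (x i) (\<lambda>j. b j + d j)) - y i * inner_vec p (x i) (\<lambda>j. b j + d j)))"
    by (rule sum_mono)
  then show ?thesis
    unfolding logistic_loss_softplus[OF assms(1)] sum.distrib sum_distrib_left[symmetric]
    by (simp add: mult.left_commute[of _ "1 / real n"] flip: distrib_left) (simp add: divide_simps mult_ac)?
qed

lemma continuous_on_logistic_loss:
  "continuous_on UNIV (\<lambda>d. logistic_loss n p x y (\<lambda>j. b j + d j))"
proof -
  have "1 + exp z \<noteq> 0" for z :: real using exp_gt_zero[of z] by linarith
  then show ?thesis
    unfolding logistic_loss_def inner_vec_def
    by (intro continuous_intros) auto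
qed

section \<open>Interior stationary points and inverses of positive definite matrices\<close>

lemma sum_abs_le_L2_set: "(\<Sum>j\<in>S. \<bar>d j\<bar>) \<le> sqrt (real (card S)) * L2_set d S"
  using L2_set_mult_ineq[of "\<lambda>_. 1" d S] by (simp add: L2_set_constant)

text \<open>
  In the product topology on \<open>nat \<Rightarrow> real\<close> this ball is a closed subset of a product of compact
  intervals, all but finitely many of them equal to \<open>{0}\<close>, so Tychonoff applies.
\<close>

lemma compact_supported_ball:
  assumes "finite S"
  shows "compact {d :: nat \<Rightarrow> real. (\<forall>j. j \<notin> S \<longrightarrow> d j = 0) \<and> L2_set d S \<le> r}"
proof -
  define B where "B j = (if j \<in> S then {- r..r} else {0 :: real})" for j :: nat
  have "compactin (product_topology (\<lambda>_. euclidean) UNIV) (PiE UNIV B)"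
    by (subst compactin_PiE) (auto simp: B_def)
  then have "compact (PiE UNIV B)"
    by (simp add: euclidean_product_topology)
  moreover have "closed {d :: nat \<Rightarrow> real. (\<forall>j. j \<notin> S \<longrightarrow> d j = 0) \<and> L2_set d S \<le> r}"
    unfolding L2_set_def
    by (intro closed_Collect_conj closed_Collect_all closed_Collect_imp closed_Collect_eq
        closed_Collect_le continuous_intros) auto
  moreover have "{d. (\<forall>j. j \<notin> S \<longrightarrow> d j = 0) \<and> L2_set d S \<le> r} \<subseteq> PiE UNIV B"
  proof
    fix d assume d: "d \<in> {d. (\<forall>j. j \<notin> S \<longrightarrow> d j = 0) \<and> L2_set d S \<le> r}"
    have "\<bar>d j\<bar> \<le> r" if "j \<in> S" for j
      using member_le_L2_set[OF assms that, of "\<lambda>j. \<bar>d j\<bar>"] d by (simp add: L2_set_def)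
    then show "d \<in> PiE UNIV B"
      using d by (force simp: B_def abs_le_iff)
  qed
  ultimately show ?thesis
    using compact_Int_closed[of "PiE UNIV B" "{d. (\<forall>j. j \<notin> S \<longrightarrow> d j = 0) \<and> L2_set d S \<le> r}"]
    by (simp only: inf.absorb2)
qed

text \<open>
  A minimiser over the closed ball exists by compactness.  It cannot lie on the sphere, where \<open>f\<close>
  exceeds its value at the centre, so its partial derivatives along \<open>S\<close> vanish.  This one fact produces both
  the restricted estimator of the primal-dual witness construction and, applied to a quadratic form,
  the inverse of a positive definite matrix.
\<close>

lemma interior_stationary_point:
  fixes f :: "(nat \<Rightarrow> real) \<Rightarrow> real"
  assumes S: "finite S" and r: "r > 0" and cont: "continuous_on UNIV f"
    and sphere: "\<And>d. (\<And>j. j \<notin> S \<Longrightarrow> d j = 0) \<Longrightarrow> L2_set d S = r \<Longrightarrow> f (\<lambda>_. 0) < f d"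
    and deriv: "\<And>d j. j \<in> S \<Longrightarrow> ((\<lambda>t. f (d(j := t))) has_real_derivative f' d j) (at (d j))"
  obtains d where "\<And>j. j \<notin> S \<Longrightarrow> d j = 0" "L2_set d S < r" "\<And>j. j \<in> S \<Longrightarrow> f' d j = 0"
proof -
  let ?K = "{d :: nat \<Rightarrow> real. (\<forall>j. j \<notin> S \<longrightarrow> d j = 0) \<and> L2_set d S \<le> r}"
  have "(\<lambda>_. 0) \<in> ?K"
    using r by (simp add: L2_set_def)
  then obtain d where d: "d \<in> ?K" and min: "\<And>e. e \<in> ?K \<Longrightarrow> f d \<le> f e"
    using continuous_attains_inf[OF compact_supported_ball[OF S] _ continuous_on_subset[OF cont subset_UNIV], of r]
    by (metis (no_types, lifting) empty_iff)
  have "L2_set d S \<noteq> r"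
    using sphere[of d] min[OF \<open>(\<lambda>_. 0) \<in> ?K\<close>] d by force
  then have less: "L2_set d S < r"
    using d by auto
  have "f' d j = 0" if j: "j \<in> S" for j
  proof -
    have "((\<lambda>t. L2_set (d(j := t)) S) \<longlongrightarrow> L2_set (d(j := d j)) S) (at (d j))"
      unfolding L2_set_def fun_upd_apply by (intro tendsto_intros) (auto intro!: tendsto_eq_intros)
    then have "eventually (\<lambda>t. L2_set (d(j := t)) S < r) (at (d j))"
      using less by (intro order_tendstoD(2)) auto
    then obtain e where e: "e > 0" "\<And>t. t \<noteq> d j \<Longrightarrow> dist t (d j) < e \<Longrightarrow> L2_set (d(j := t)) S < r"
      unfolding eventually_at by blast
    have "f d \<le> f (d(j := t))" if "\<bar>d j - t\<bar> < e" for t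
    proof (cases "t = d j")
      case False
      then have "d(j := t) \<in> ?K"
        using e(2)[of t] that d j by (auto simp: dist_real_def abs_minus_commute less_imp_le)
      then show ?thesis by (rule min)
    qed simp
    then show ?thesis
      using DERIV_local_min[OF deriv[OF j] e(1)] by simp
  qed
  then show ?thesis
    using that d less by blast
qed

text \<open>
  The equation \<open>A v = b\<close> is the stationarity condition of \<open>v \<mapsto> v\<^sup>T A v / 2 - b\<^sup>T v\<close>, which is
  positive on every sphere of sufficiently large radius; its solutions form the columns of a right
  inverse \<open>B\<close>.  Since \<open>A (B A - I) = (A B - I) A = 0\<close> and \<open>A\<close> is injective, \<open>B\<close> is a left inverse
  as well.
\<close>

lemma exists_inverse_of_coercive:
  fixes A :: "nat \<Rightarrow> nat \<Rightarrow> real"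
  assumes S: "finite S" and sym: "\<And>j k. j \<in> S \<Longrightarrow> k \<in> S \<Longrightarrow> A j k = A k j" and lam: "lam > 0"
    and coercive: "\<And>v. lam * (L2_set v S)\<^sup>2 \<le> (\<Sum>j\<in>S. \<Sum>k\<in>S. v j * A j k * v k)"
  obtains B where "\<And>i j. i \<in> S \<Longrightarrow> j \<in> S \<Longrightarrow> mult_mat S A B i j = id_mat i j"
    "\<And>i j. i \<in> S \<Longrightarrow> j \<in> S \<Longrightarrow> mult_mat S B A i j = id_mat i j"
proof -
  have solve: "\<exists>v. \<forall>j\<in>S. (\<Sum>k\<in>S. A j k * v k) = b j" for b
  proof -
    \<comment> \<open>Twice \<open>\<parallel>b\<parallel> / lam\<close> is where the quadratic lower bound overtakes the linear term; the \<open>+ 1\<close> makes this strict.\<close>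
    define r where "r = 2 * (L2_set b S + 1) / lam"
    let ?Q = "\<lambda>v. (\<Sum>j\<in>S. \<Sum>k\<in>S. v j * A j k * v k) / 2 - (\<Sum>j\<in>S. b j * v j)"
    have r: "r > 0"
      using lam by (simp add: r_def add_nonneg_pos)
    have sphere: "?Q (\<lambda>_. 0) < ?Q v" if "L2_set v S = r" for v
    proof -
      have "(\<Sum>j\<in>S. b j * v j) \<le> L2_set b S * r"
        using L2_set_mult_ineq[of b v S] that sum_mono[of S "\<lambda>j. b j * v j" "\<lambda>j. \<bar>b j\<bar> * \<bar>v j\<bar>"]
        by (simp add: abs_ge_self flip: abs_mult)
      moreover have "lam * r\<^sup>2 / 2 = (L2_set b S + 1) * r"
        using lam by (simp add: r_def power2_eq_square field_simps)
      ultimately show ?thesis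
        using coercive[of v] that r by (simp add: algebra_simps)
    qed
    have deriv: "((\<lambda>t. ?Q (v(j := t))) has_real_derivative (\<Sum>k\<in>S. A j k * v k) - b j) (at (v j))"
      if j: "j \<in> S" for v j
    proof -
      have coord: "((\<lambda>t. (v(j := t)) i) has_real_derivative (if i = j then 1 else 0)) (at (v j))" for i
        by (cases "i = j") auto
      have "((\<lambda>t. (v(j := t)) i * A i k * (v(j := t)) k) has_real_derivative
          (if i = j then 1 else 0) * A i k * v k + v i * A i k * (if k = j then 1 else 0)) (at (v j))" for i k
      proof -
        have self: "(v(j := v j)) l = v l" for l by simp
        from DERIV_mult[OF DERIV_mult[OF coord[of i] DERIV_const[of "A i k"]] coord[of k]]
        show ?thesis unfolding self by (rule DERIV_cong) (simp add: mult_ac)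
      qed
      then have "((\<lambda>t. ?Q (v(j := t))) has_real_derivative
          (\<Sum>i\<in>S. \<Sum>k\<in>S. (if i = j then 1 else 0) * A i k * v k + v i * A i k * (if k = j then 1 else 0)) / 2
          - (\<Sum>i\<in>S. b i * (if i = j then 1 else 0))) (at (v j))"
        by (intro DERIV_diff DERIV_cdivide DERIV_sum DERIV_cmult coord)
      moreover have "(\<Sum>i\<in>S. \<Sum>k\<in>S. (if i = j then 1 else 0) * A i k * v k + v i * A i k * (if k = j then 1 else 0))
          = 2 * (\<Sum>k\<in>S. A j k * v k)"
      proof -
        have "(\<Sum>i\<in>S. \<Sum>k\<in>S. (if i = j then 1 else 0) * A i k * v k)
            = (\<Sum>i\<in>S. if i = j then \<Sum>k\<in>S. A i k * v k else 0)"
          by (rule sum.cong) auto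
        moreover have "(\<Sum>i\<in>S. \<Sum>k\<in>S. v i * A i k * (if k = j then 1 else 0)) = (\<Sum>i\<in>S. v i * A i j)"
          using S j by (simp add: if_distrib[of "\<lambda>u. _ * u"] cong: if_cong)
        moreover have "\<dots> = (\<Sum>k\<in>S. A j k * v k)"
          using sym j by (intro sum.cong) (auto simp: mult.commute)
        ultimately show ?thesis
          using S j by (simp add: sum.distrib)
      qed
      moreover have "(\<Sum>i\<in>S. b i * (if i = j then 1 else 0)) = b j"
        using j S by (simp add: if_distrib[of "\<lambda>u. _ * u"] cong: if_cong)
      ultimately show ?thesis
        by simp
    qed
    have cont: "continuous_on UNIV ?Q"
      by (intro continuous_intros) auto
    obtain v where "\<And>j. j \<in> S \<Longrightarrow> (\<Sum>k\<in>S. A j k * v k) - b j = 0"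
      by (rule interior_stationary_point[of S r ?Q "\<lambda>v j. (\<Sum>k\<in>S. A j k * v k) - b j",
            OF S r cont sphere deriv]) blast+
    then show ?thesis by auto
  qed
  have inj: "v j = 0" if "\<And>j. j \<in> S \<Longrightarrow> (\<Sum>k\<in>S. A j k * v k) = 0" "j \<in> S" for v j
  proof -
    have "(\<Sum>j\<in>S. \<Sum>k\<in>S. v j * A j k * v k) = 0"
      using that(1) by (simp add: mult.assoc flip: sum_distrib_left)
    then have "(L2_set v S)\<^sup>2 \<le> 0"
      using coercive[of v] lam by (simp add: mult_le_0_iff)
    then show ?thesis
      using S that(2) L2_set_eq_0_iff[of S v] by simp
  qed
  define B where "B k i = (SOME v. \<forall>j\<in>S. (\<Sum>k\<in>S. A j k * v k) = id_mat j i) k" for k i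
  have AB: "mult_mat S A B i j = id_mat i j" if "i \<in> S" for i j
    using someI_ex[OF solve[of "\<lambda>i. id_mat i j"]] that by (simp add: mult_mat_def B_def)
  have "mult_mat S B A i j = id_mat i j" if ij: "i \<in> S" "j \<in> S" for i j
  proof -
    have "(\<Sum>k\<in>S. A l k * (mult_mat S B A k j - id_mat k j)) = 0" if l: "l \<in> S" for l
    proof -
      have "(\<Sum>k\<in>S. A l k * mult_mat S B A k j) = (\<Sum>m\<in>S. mult_mat S A B l m * A m j)"
        unfolding mult_mat_def sum_distrib_left sum_distrib_right
        by (subst sum.swap) (simp add: mult.assoc)
      also have "\<dots> = A l j"
        using S l by (simp add: AB id_mat_def if_distrib[of "\<lambda>u. u * _"] cong: if_cong)
      also have "\<dots> = (\<Sum>k\<in>S. A l k * id_mat k j)"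
        using S ij by (simp add: id_mat_def if_distrib[of "\<lambda>u. _ * u"] cong: if_cong)
      finally show ?thesis
        by (simp add: right_diff_distrib sum_subtractf)
    qed
    from inj[OF this ij(1)] show ?thesis by simp
  qed
  with AB that show ?thesis by blast
qed

lemma loewner_ge_coercive:
  assumes S: "finite S" and ge: "loewner_ge S A (\<lambda>j k. lam * id_mat j k)"
  shows "lam * (L2_set v S)\<^sup>2 \<le> (\<Sum>j\<in>S. \<Sum>k\<in>S. v j * A j k * v k)"
proof -
  have "(\<Sum>j\<in>S. \<Sum>k\<in>S. v j * (lam * id_mat j k) * v k) = lam * (L2_set v S)\<^sup>2"
    using S by (simp add: id_mat_def L2_set_def sum_nonneg sum_distrib_left power2_eq_square
        if_distrib[of "\<lambda>u. _ * u"] if_distrib[of "\<lambda>u. u * _"] mult_ac cong: if_cong)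
  moreover have "0 \<le> (\<Sum>j\<in>S. \<Sum>k\<in>S. v j * (A j k - lam * id_mat j k) * v k)"
    using ge unfolding loewner_ge_def pos_semidef_def by blast
  ultimately show ?thesis
    by (simp add: right_diff_distrib left_diff_distrib sum_subtractf)
qed

text \<open>
  The existence of a two-sided inverse is what makes the choice in \<open>inv_mat\<close> meaningful.
\<close>

lemma inv_mat_left_inverse:
  assumes S: "finite S" and lam: "lam > 0" and ge: "loewner_ge S A (\<lambda>j k. lam * id_mat j k)"
    and ij: "i \<in> S" "j \<in> S"
  shows "mult_mat S (inv_mat S A) A i j = id_mat i j"
proof -
  have sym: "A j k = A k j" if "j \<in> S" "k \<in> S" for j k
    using ge that unfolding loewner_ge_def pos_semidef_def by (auto simp: id_mat_def split: if_splits)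
  have "\<exists>B. \<forall>i\<in>S. \<forall>j\<in>S. mult_mat S A B i j = id_mat i j \<and> mult_mat S B A i j = id_mat i j"
    by (rule exists_inverse_of_coercive[OF S sym lam loewner_ge_coercive[OF S ge]]) blast+
  from someI_ex[OF this] show ?thesis
    unfolding inv_mat_def using ij by blast
qed

section \<open>Support recovery for a fixed sample\<close>

text \<open>
  If \<open>b\<close> satisfies the optimality conditions of the penalised problem and the dual variables are
  strictly below \<open>\<tau>\<close> off \<open>S\<close>, then raising \<open>\<bar>a j\<bar>\<close> off \<open>S\<close> costs at least
  \<open>(\<tau> - \<bar>g j\<bar>) * \<bar>a j\<bar>\<close> more than it can gain.  So every point \<open>a\<close> that does no worse than \<open>b\<close>
  vanishes off \<open>S\<close>.
\<close>

lemma l1_dual_certificate: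
  assumes tangent: "L b + (\<Sum>j = 1..p. g j * (a j - b j)) \<le> L a"
    and le: "L a + \<tau> * l1_norm p a \<le> L b + \<tau> * l1_norm p b" and \<tau>: "0 < \<tau>"
    and S: "S \<subseteq> {1..p}" and b: "\<And>j. j \<in> {1..p} - S \<Longrightarrow> b j = 0"
    and stationary: "\<And>j. j \<in> S \<Longrightarrow> g j = - \<tau> * sgn (b j)"
    and dual: "\<And>j. j \<in> {1..p} - S \<Longrightarrow> \<bar>g j\<bar> < \<tau>"
    and j: "j \<in> {1..p} - S"
  shows "a j = 0"
proof -
  let ?e = "\<lambda>j. g j * (a j - b j) + \<tau> * \<bar>a j\<bar> - \<tau> * \<bar>b j\<bar>"
  have nonneg: "0 \<le> ?e k" if "k \<in> {1..p}" for k
  proof (cases "k \<in> S")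
    case True
    have "sgn (b k) * a k \<le> \<bar>a k\<bar>" and "sgn (b k) * b k = \<bar>b k\<bar>"
      by (auto simp: sgn_if)
    then have "\<tau> * (sgn (b k) * a k) \<le> \<tau> * \<bar>a k\<bar>" "?e k = \<tau> * \<bar>a k\<bar> - \<tau> * (sgn (b k) * a k)"
      using \<tau> by (auto simp: stationary[OF True] algebra_simps)
    then show ?thesis by simp
  next
    case False
    then have "- (g k * a k) \<le> \<tau> * \<bar>a k\<bar>"
      using dual[of k] that mult_right_mono[of "\<bar>g k\<bar>" \<tau> "\<bar>a k\<bar>"] abs_ge_minus_self[of "g k * a k"]
      by (auto simp: abs_mult)
    then show ?thesis
      using b[of k] False that by simp
  qed
  have "(\<Sum>k = 1..p. ?e k) \<le> 0"
    using tangent le by (simp add: l1_norm_def sum.distrib sum_subtractf flip: sum_distrib_left)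
  then have "?e j \<le> 0"
    using member_le_sum[of j "{1..p}" ?e] nonneg j by fastforce
  then have "(\<tau> - \<bar>g j\<bar>) * \<bar>a j\<bar> \<le> 0"
    using b[OF j] abs_ge_minus_self[of "g j * a j"] by (simp add: left_diff_distrib abs_mult)
  then show ?thesis
    using dual[OF j] by (simp add: mult_le_0_iff)
qed

lemma abs_inner_vec_supported_le:
  assumes S: "S \<subseteq> {1..p}" and d: "\<And>j. j \<notin> S \<Longrightarrow> d j = 0"
    and \<nu>: "L2_set v S \<le> \<nu>" and r: "L2_set d S \<le> r"
  shows "\<bar>inner_vec p v d\<bar> \<le> \<nu> * r"
proof -
  have "\<bar>inner_vec p v d\<bar> \<le> (\<Sum>j\<in>S. \<bar>v j\<bar> * \<bar>d j\<bar>)"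
    using inner_vec_supported[of S p d v, OF S d] sum_abs[of "\<lambda>j. v j * d j" S] by (simp add: abs_mult)
  also have "\<dots> \<le> L2_set v S * L2_set d S"
    by (rule L2_set_mult_ineq)
  also have "\<dots> \<le> \<nu> * r"
    using \<nu> r order_trans[OF L2_set_nonneg \<nu>] by (intro mult_mono) auto
  finally show ?thesis .
qed

text \<open>
  On the rows of \<open>R\<close> one has \<open>H d = (H (inv_mat S H)) (H d)\<close>, since the inverse cancels on \<open>S\<close>.  The
  irrepresentability condition bounds the first factor, so control of \<open>H d\<close> on \<open>S\<close>, which
  stationarity provides, carries over to the rows outside \<open>S\<close>.
\<close>

lemma irrepresentable_bound:
  assumes S: "finite S" and lam: "lam > 0" and ge: "loewner_ge S H (\<lambda>j k. lam * id_mat j k)"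
    and R: "finite R" "j \<in> R"
    and irrep: "linf_op_norm R S (mult_mat S H (inv_mat S H)) < q"
    and u: "\<And>l. l \<in> S \<Longrightarrow> \<bar>\<Sum>k\<in>S. H l k * d k\<bar> \<le> u"
    and u_pos: "0 < u"
  shows "\<bar>\<Sum>k\<in>S. H j k * d k\<bar> \<le> q * u"
proof -
  let ?G = "mult_mat S H (inv_mat S H)"
  have "(\<Sum>l\<in>S. ?G j l * (\<Sum>k\<in>S. H l k * d k))
      = (\<Sum>m\<in>S. H j m * (\<Sum>k\<in>S. mult_mat S (inv_mat S H) H m k * d k))"
  proof -
    have "(\<Sum>l\<in>S. ?G j l * (\<Sum>k\<in>S. H l k * d k))
        = (\<Sum>l\<in>S. \<Sum>m\<in>S. \<Sum>k\<in>S. H j m * inv_mat S H m l * H l k * d k)"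
      by (simp add: mult_mat_def sum_distrib_left sum_distrib_right mult_ac)
    also have "\<dots> = (\<Sum>m\<in>S. \<Sum>k\<in>S. \<Sum>l\<in>S. H j m * inv_mat S H m l * H l k * d k)"
      by (subst sum.swap) (intro sum.cong refl sum.swap)
    finally show ?thesis
      by (simp add: mult_mat_def sum_distrib_left sum_distrib_right mult_ac)
  qed
  also have "\<dots> = (\<Sum>m\<in>S. H j m * d m)"
    using S by (intro sum.cong refl)
      (simp add: inv_mat_left_inverse[OF S lam ge] id_mat_def if_distrib[of "\<lambda>u. u * _"] cong: if_cong)
  finally have eq: "(\<Sum>k\<in>S. H j k * d k) = (\<Sum>l\<in>S. ?G j l * (\<Sum>k\<in>S. H l k * d k))" ..
  have "\<bar>\<Sum>k\<in>S. H j k * d k\<bar> \<le> (\<Sum>l\<in>S. \<bar>?G j l\<bar> * u)"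
    unfolding eq
    by (rule order_trans[OF sum_abs], rule sum_mono) (auto simp: abs_mult intro!: mult_left_mono u)
  also have "\<dots> = (\<Sum>l\<in>S. \<bar>?G j l\<bar>) * u"
    by (simp add: sum_distrib_right)
  also have "\<dots> \<le> q * u"
  proof (rule mult_right_mono)
    have "(\<Sum>l\<in>S. \<bar>?G j l\<bar>) \<le> linf_op_norm R S ?G"
      unfolding linf_op_norm_def using R by (intro Max_ge) auto
    then show "(\<Sum>l\<in>S. \<bar>?G j l\<bar>) \<le> q"
      using irrep by simp
  qed (use u_pos in simp)
  finally show ?thesis .
qed

text \<open>
  The primal-dual witness argument for a fixed sample.  On vectors supported in \<open>S\<close>, replace the
  penalty by \<open>\<tau>\<close> times the linear function \<open>\<Sum>j\<in>S. sgn (bs j) * (bs j + d j)\<close>.  The resulting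
  objective \<open>f\<close> is smooth and convex, is at most the penalised objective, and agrees with it
  wherever the signs are those of \<open>bs\<close>.

  By \<open>radius\<close> and \<open>cubic\<close>, the quadratic growth of the loss beats the score and the penalty on
  the sphere of radius \<open>r\<close>, where \<open>3 / 8 = 1 / 2 - 1 / 8\<close> is the part of the quadratic term that the
  cubic error leaves over.  So \<open>f\<close> has a stationary point inside.  By \<open>signal\<close> that point has the
  signs of \<open>bs\<close>, hence it satisfies the optimality conditions of the penalised problem on \<open>S\<close>.  Off
  \<open>S\<close> its gradient is, up to the score and the Taylor remainder, the image under the matrix of
  the irrepresentability condition of a vector of size at most \<open>(1 + 2 * \<delta>) * \<tau>\<close>.  Thus its absolute
  values are at most \<open>((1 - \<alpha>) * (1 + 2 * \<delta>) + 2 * \<delta>) * \<tau> < \<tau>\<close>, and \<open>bh\<close> vanishes off \<open>S\<close>.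

  Conversely, \<open>bh\<close> lies within the ball: otherwise, by convexity, the segment from \<open>bs\<close> to \<open>bh\<close>
  would cross the sphere at a point where \<open>f\<close> is no larger than at \<open>bs\<close>.  Within the ball no
  coordinate of \<open>S\<close> can reach zero.
\<close>

lemma logistic_lasso_support:
  fixes x :: "nat \<Rightarrow> nat \<Rightarrow> real"
  assumes n: "n \<ge> 1" and y: "y \<in> {1..n} \<rightarrow> {0, 1}" and S: "S = supp_vec p bs"
    and \<tau>: "0 < \<tau>" and lam: "0 < lam" and \<delta>: "0 < \<delta>" "4 * \<delta> < \<alpha>" "\<alpha> \<le> 1" and r: "0 < r"
    and \<nu>: "\<And>i. i \<in> {1..n} \<Longrightarrow> L2_set (x i) S \<le> \<nu>"
    and \<gamma>: "\<And>i j. i \<in> {1..n} \<Longrightarrow> j \<in> {1..p} \<Longrightarrow> \<bar>x i j\<bar> \<le> \<gamma>"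
    and psd: "loewner_ge S (hessian (logistic_loss n p x y) bs) (\<lambda>j k. lam * id_mat j k)"
    and irrep: "linf_op_norm ({1..p} - S) S (mult_mat S (hessian (logistic_loss n p x y) bs)
      (inv_mat S (hessian (logistic_loss n p x y) bs))) < 1 - \<alpha>"
    and score: "\<And>j. j \<in> {1..p} \<Longrightarrow> \<bar>loss_grad n p x y bs j\<bar> \<le> \<delta> * \<tau>"
    and signal: "\<And>j. j \<in> S \<Longrightarrow> r < \<bar>bs j\<bar>"
    and remainder: "\<gamma> * (\<nu> * r)\<^sup>2 / 2 \<le> \<delta> * \<tau>"
    and cubic: "(\<nu> * r) ^ 3 / 6 \<le> lam * r\<^sup>2 / 8"
    and radius: "(1 + \<delta>) * \<tau> * sqrt (real (card S)) < 3 / 8 * lam * r"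
    and argmin: "is_arg_min (\<lambda>b. logistic_loss n p x y b + \<tau> * l1_norm p b) (\<lambda>_. True) bh"
  shows "supp_vec p bh = S"
proof -
  let ?L = "logistic_loss n p x y" and ?W = "loss_grad n p x y bs"
  let ?H = "hessian ?L bs"
  define f where "f d = ?L (\<lambda>j. bs j + d j) + \<tau> * (\<Sum>j\<in>S. sgn (bs j) * (bs j + d j))" for d
  have SP: "S \<subseteq> {1..p}" and finS: "finite S"
    using S by (auto simp: supp_vec_def)
  have off: "bs j = 0" if "j \<in> {1..p} - S" for j
    using that S by (auto simp: supp_vec_def)
  have hess: "?H j k = loss_hess n p x bs j k" if "j \<in> {1..p}" "k \<in> {1..p}" for j k
    using hessian_logistic_loss[OF y that] .
  have coercive: "lam * (L2_set v S)\<^sup>2 \<le> (\<Sum>j\<in>S. \<Sum>k\<in>S. v j * ?H j k * v k)" for v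
    by (rule loewner_ge_coercive[OF finS psd])
  have sphere: "f (\<lambda>_. 0) < f d" if d: "\<And>j. j \<notin> S \<Longrightarrow> d j = 0" and dr: "L2_set d S = r" for d
  proof -
    have "?L bs + (\<Sum>j\<in>S. ?W j * d j) + (\<Sum>j\<in>S. \<Sum>k\<in>S. d j * loss_hess n p x bs j k * d k) / 2
        - (\<nu> * r) ^ 3 / 6 \<le> ?L (\<lambda>j. bs j + d j)"
      using abs_inner_vec_supported_le[of S p d, OF SP d \<nu>] dr
      by (intro logistic_loss_quadratic_lower[OF y SP d n]) auto
    moreover have "(\<Sum>j\<in>S. \<Sum>k\<in>S. d j * loss_hess n p x bs j k * d k) \<ge> lam * r\<^sup>2"
    proof -
      have "(\<Sum>j\<in>S. \<Sum>k\<in>S. d j * loss_hess n p x bs j k * d k) = (\<Sum>j\<in>S. \<Sum>k\<in>S. d j * ?H j k * d k)"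
        using SP by (intro sum.cong refl) (auto simp: hess subset_iff)
      then show ?thesis
        using coercive[of d] dr by simp
    qed
    moreover have "\<bar>\<Sum>j\<in>S. (?W j + \<tau> * sgn (bs j)) * d j\<bar> \<le> (1 + \<delta>) * \<tau> * sqrt (real (card S)) * r"
    proof -
      have "\<bar>\<Sum>j\<in>S. (?W j + \<tau> * sgn (bs j)) * d j\<bar> \<le> (\<Sum>j\<in>S. (1 + \<delta>) * \<tau> * \<bar>d j\<bar>)"
      proof (rule order_trans[OF sum_abs], rule sum_mono)
        fix j assume j: "j \<in> S"
        have "\<bar>?W j + \<tau> * sgn (bs j)\<bar> \<le> \<delta> * \<tau> + \<tau>"
          using score[of j] j SP \<tau> by (auto simp: sgn_if abs_le_iff subset_iff split: if_splits)
        then show "\<bar>(?W j + \<tau> * sgn (bs j)) * d j\<bar> \<le> (1 + \<delta>) * \<tau> * \<bar>d j\<bar>"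
          unfolding abs_mult by (intro mult_right_mono) (auto simp: algebra_simps)
      qed
      also have "\<dots> = (1 + \<delta>) * \<tau> * (\<Sum>j\<in>S. \<bar>d j\<bar>)"
        by (simp add: sum_distrib_left)
      also have "\<dots> \<le> (1 + \<delta>) * \<tau> * (sqrt (real (card S)) * r)"
        using sum_abs_le_L2_set[of d S] \<delta> \<tau> dr by (intro mult_left_mono) auto
      finally show ?thesis by (simp add: mult.assoc)
    qed
    moreover have "(1 + \<delta>) * \<tau> * sqrt (real (card S)) * r < 3 / 8 * lam * r\<^sup>2"
      using mult_strict_right_mono[OF radius r] by (simp add: power2_eq_square mult_ac)
    moreover have "f d - f (\<lambda>_. 0) = ?L (\<lambda>j. bs j + d j) - ?L bs + (\<Sum>j\<in>S. \<tau> * sgn (bs j) * d j)"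
      by (simp add: f_def sum.distrib sum_distrib_left algebra_simps)
    moreover have "(\<Sum>j\<in>S. (?W j + \<tau> * sgn (bs j)) * d j) = (\<Sum>j\<in>S. ?W j * d j) + (\<Sum>j\<in>S. \<tau> * sgn (bs j) * d j)"
      by (simp add: sum.distrib algebra_simps)
    ultimately show ?thesis
      using cubic by linarith
  qed
  have deriv: "((\<lambda>t. f (d(j := t))) has_real_derivative
      (loss_grad n p x y (\<lambda>j. bs j + d j) j + \<tau> * sgn (bs j))) (at (d j))" if j: "j \<in> S" for d j
  proof -
    have upd: "(\<lambda>k. bs k + (d(j := t)) k) = (\<lambda>k. bs k + d k)(j := bs j + t)" for t
      by auto
    have lin: "((\<lambda>t. bs j + t) has_real_derivative 1) (at (d j))"
      by (auto intro!: derivative_eq_intros)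
    have "((\<lambda>t. ?L (\<lambda>k. bs k + (d(j := t)) k)) has_real_derivative loss_grad n p x y (\<lambda>j. bs j + d j) j) (at (d j))"
      unfolding upd
      using DERIV_chain2[OF DERIV_logistic_loss[OF y, of j p x "\<lambda>k. bs k + d k"] lin] j SP by auto
    moreover have "((\<lambda>t. \<tau> * (\<Sum>k\<in>S. sgn (bs k) * (bs k + (d(j := t)) k))) has_real_derivative \<tau> * sgn (bs j)) (at (d j))"
    proof -
      have "((\<lambda>t. sgn (bs k) * (bs k + (d(j := t)) k)) has_real_derivative (if k = j then sgn (bs j) else 0)) (at (d j))" for k
        by (cases "k = j") (auto intro!: derivative_eq_intros)
      then have "((\<lambda>t. \<tau> * (\<Sum>k\<in>S. sgn (bs k) * (bs k + (d(j := t)) k))) has_real_derivative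
          \<tau> * (\<Sum>k\<in>S. if k = j then sgn (bs j) else 0)) (at (d j))"
        by (intro DERIV_cmult DERIV_sum)
      then show ?thesis
        using j finS by simp
    qed
    ultimately show ?thesis
      unfolding f_def by (rule DERIV_add)
  qed
  have "continuous_on UNIV f"
    unfolding f_def by (intro continuous_intros continuous_on_logistic_loss) auto
  then obtain d where d: "\<And>j. j \<notin> S \<Longrightarrow> d j = 0" and dr: "L2_set d S < r"
    and stat: "\<And>j. j \<in> S \<Longrightarrow> loss_grad n p x y (\<lambda>j. bs j + d j) j + \<tau> * sgn (bs j) = 0"
    using interior_stationary_point[OF finS r, of f, OF _ sphere deriv] by blast
  let ?b = "\<lambda>j. bs j + d j"
  have sgn_eq: "sgn (?b j) = sgn (bs j)" if "j \<in> S" for j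
  proof -
    have "\<bar>d j\<bar> < \<bar>bs j\<bar>"
      using member_le_L2_set[OF finS that, of "\<lambda>j. \<bar>d j\<bar>"] dr signal[OF that] by (simp add: L2_set_def)
    then show ?thesis
      by (auto simp: sgn_if)
  qed
  have approx: "\<bar>loss_grad n p x y ?b j - ?W j - (\<Sum>k\<in>S. ?H j k * d k)\<bar> \<le> \<delta> * \<tau>" if j: "j \<in> {1..p}" for j
  proof -
    have "\<bar>loss_grad n p x y ?b j - ?W j - (\<Sum>k\<in>S. loss_hess n p x bs j k * d k)\<bar> \<le> \<gamma> * (\<nu> * r)\<^sup>2 / 2"
      using abs_inner_vec_supported_le[of S p d, OF SP d \<nu>] dr \<gamma> j
      by (intro loss_grad_linear_approx[OF SP d n]) auto
    moreover have "(\<Sum>k\<in>S. loss_hess n p x bs j k * d k) = (\<Sum>k\<in>S. ?H j k * d k)"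
      using SP j by (intro sum.cong refl) (auto simp: hess subset_iff)
    ultimately show ?thesis
      using remainder by simp
  qed
  have dual: "\<bar>loss_grad n p x y ?b j\<bar> < \<tau>" if j: "j \<in> {1..p} - S" for j
  proof -
    have "\<bar>\<Sum>k\<in>S. ?H l k * d k\<bar> \<le> (1 + 2 * \<delta>) * \<tau>" if l: "l \<in> S" for l
    proof -
      have "l \<in> {1..p}" using l SP by auto
      moreover have "\<bar>\<tau> * sgn (bs l)\<bar> \<le> \<tau>"
        using \<tau> by (simp add: abs_mult abs_sgn_eq)
      ultimately show ?thesis
        using approx[of l] score[of l] stat[OF l] by (simp add: algebra_simps abs_le_iff)
    qed
    then have "\<bar>\<Sum>k\<in>S. ?H j k * d k\<bar> \<le> (1 - \<alpha>) * ((1 + 2 * \<delta>) * \<tau>)"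
      using \<delta> \<tau> by (intro irrepresentable_bound[OF finS lam psd _ j irrep]) auto
    moreover have "(1 - \<alpha>) * ((1 + 2 * \<delta>) * \<tau>) + 2 * (\<delta> * \<tau>) < \<tau>"
    proof -
      have "(1 - \<alpha>) * (1 + 2 * \<delta>) + 2 * \<delta> < 1"
      proof -
        have "0 < \<alpha> * \<delta>"
          using \<delta> by (intro mult_pos_pos) auto
        moreover have "(1 - \<alpha>) * (1 + 2 * \<delta>) + 2 * \<delta> = 1 - \<alpha> + 4 * \<delta> - 2 * (\<alpha> * \<delta>)"
          by (simp add: algebra_simps)
        ultimately show ?thesis
          using \<delta> by linarith
      qed
      from mult_strict_right_mono[OF this \<tau>] show ?thesis by (simp add: algebra_simps)
    qed
    ultimately show ?thesis
      using approx[of j] score[of j] j by (auto simp: abs_less_iff abs_le_iff)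
  qed
  have opt: "?L bh + \<tau> * l1_norm p bh \<le> ?L b + \<tau> * l1_norm p b" for b
    using argmin by (simp add: is_arg_min_linorder)
  have bh_off: "bh j = 0" if "j \<in> {1..p} - S" for j
  proof (rule l1_dual_certificate[OF logistic_loss_above_tangent[OF y] opt \<tau> SP _ _ dual that])
    show "?b k = 0" if "k \<in> {1..p} - S" for k
      using d[of k] off[OF that] that by simp
    show "loss_grad n p x y ?b k = - \<tau> * sgn (?b k)" if "k \<in> S" for k
      using stat[OF that] by (simp add: sgn_eq[OF that])
  qed
  \<comment> \<open>Off \<open>S\<close>, both vectors vanish within \<open>{1..p}\<close> and are arbitrary beyond, hence the cut-off.\<close>
  define e where "e j = (if j \<in> S then bh j - bs j else 0)" for j
  have e_off: "e j = 0" if "j \<notin> S" for j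
    using that by (simp add: e_def)
  have be: "bs j + e j = bh j" if "j \<in> {1..p}" for j
    using that bh_off off by (auto simp: e_def)
  have "f e \<le> f (\<lambda>_. 0)"
  proof -
    have "?L (\<lambda>j. bs j + e j) = ?L bh"
    proof -
      have "inner_vec p v (\<lambda>j. bs j + e j) = inner_vec p v bh" for v
        by (rule inner_vec_cong) (rule be)
      then show ?thesis
        by (simp add: logistic_loss_def)
    qed
    moreover have "(\<Sum>j\<in>S. sgn (bs j) * (bs j + e j)) \<le> l1_norm p bh"
    proof -
      have "(\<Sum>j\<in>S. sgn (bs j) * (bs j + e j)) \<le> (\<Sum>j\<in>S. \<bar>bh j\<bar>)"
      proof (rule sum_mono)
        fix j assume "j \<in> S"
        then have "bs j + e j = bh j"
          using SP by (intro be) auto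
        then show "sgn (bs j) * (bs j + e j) \<le> \<bar>bh j\<bar>"
          by (auto simp: sgn_if abs_if)
      qed
      also have "\<dots> \<le> l1_norm p bh"
        unfolding l1_norm_def by (rule sum_mono2) (use SP in auto)
      finally show ?thesis .
    qed
    moreover have "l1_norm p bs = (\<Sum>j\<in>S. sgn (bs j) * bs j)"
      unfolding l1_norm_def using SP off
      by (intro sum.mono_neutral_cong_right) (auto simp: sgn_if)
    moreover from calculation(2) have "\<tau> * (\<Sum>j\<in>S. sgn (bs j) * (bs j + e j)) \<le> \<tau> * l1_norm p bh"
      using \<tau> by (intro mult_left_mono) auto
    moreover have "f (\<lambda>_. 0) = ?L bs + \<tau> * (\<Sum>j\<in>S. sgn (bs j) * bs j)"
      by (simp add: f_def)
    ultimately show ?thesis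
      using opt[of bs] unfolding f_def by simp
  qed
  have "L2_set e S \<le> r"
  proof (rule ccontr)
    assume far: "\<not> L2_set e S \<le> r"
    define t where "t = r / L2_set e S"
    have t: "0 < t" "t < 1"
      using far r by (auto simp: t_def)
    have "L2_set (\<lambda>j. t * e j) S = r"
      using far r t L2_set_right_distrib[of t e S] by (simp add: t_def)
    then have "f (\<lambda>_. 0) < f (\<lambda>j. t * e j)"
      using e_off by (intro sphere) auto
    also have "\<dots> \<le> (1 - t) * f (\<lambda>_. 0) + t * f e"
    proof -
      define A B where "A = (\<Sum>j\<in>S. sgn (bs j) * bs j)" and "B = (\<Sum>j\<in>S. sgn (bs j) * (bs j + e j))"
      have "(\<Sum>j\<in>S. sgn (bs j) * (bs j + t * e j)) = (1 - t) * A + t * B"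
        by (simp add: A_def B_def algebra_simps sum.distrib sum_distrib_left sum_subtractf)
      then have "f (\<lambda>j. t * e j) = ?L (\<lambda>j. bs j + t * e j) + \<tau> * ((1 - t) * A + t * B)"
        by (simp only: f_def)
      moreover have "f (\<lambda>_. 0) = ?L bs + \<tau> * A" "f e = ?L (\<lambda>j. bs j + e j) + \<tau> * B"
        by (simp_all add: f_def A_def B_def)
      ultimately show ?thesis
        using logistic_loss_segment[OF y, of t p x bs e] t by (simp add: algebra_simps)
    qed
    also have "\<dots> \<le> (1 - t) * f (\<lambda>_. 0) + t * f (\<lambda>_. 0)"
      using \<open>f e \<le> f (\<lambda>_. 0)\<close> t by (intro add_left_mono mult_left_mono) auto
    finally show False
      by (simp add: algebra_simps)
  qed
  have "bh j \<noteq> 0" if "j \<in> S" for j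
    using member_le_L2_set[OF finS that, of "\<lambda>j. \<bar>e j\<bar>"] \<open>L2_set e S \<le> r\<close> signal[OF that] that
    by (auto simp: L2_set_def e_def)
  with bh_off SP show ?thesis
    by (auto simp: supp_vec_def)
qed

text \<open>
  With \<open>r = (\<alpha> + 4) / lam * sqrt s * \<tau>\<close> and \<open>\<delta> = c / 5\<close>, both Taylor errors are controlled by the single
  quantity \<open>s * \<nu>\<^sup>2 * \<gamma> * \<tau>\<close>.  For the remainder of the gradient this is immediate.  For the cubic
  error \<open>\<nu>\<^sup>3 * r\<close> it follows from \<open>\<nu> \<le> sqrt s * \<gamma>\<close>, which compares the Euclidean norm of a vector
  on \<open>S\<close> with its largest entry.  The factor \<open>\<alpha> + 4\<close> in \<open>r\<close> gives \<open>radius\<close> with room to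
  spare, as \<open>3 / 8 * 4 > 1 + c / 5\<close>.
\<close>

lemma logistic_lasso_support_rate:
  fixes x :: "nat \<Rightarrow> nat \<Rightarrow> real"
  assumes n: "n \<ge> 1" and y: "y \<in> {1..n} \<rightarrow> {0, 1}" and S: "S = supp_vec p bs" and s: "card S \<le> s"
    and \<tau>: "0 < \<tau>" and c: "0 < c" "c \<le> lam" "c \<le> \<alpha>" "\<alpha> \<le> 1"
    and \<nu>: "\<nu> = max_l2_on n S x" and \<gamma>: "\<gamma> = max_linf n p x"
    and psd: "loewner_ge S (hessian (logistic_loss n p x y) bs) (\<lambda>j k. lam * id_mat j k)"
    and irrep: "linf_op_norm ({1..p} - S) S (mult_mat S (hessian (logistic_loss n p x y) bs)
      (inv_mat S (hessian (logistic_loss n p x y) bs))) < 1 - \<alpha>"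
    and signal: "\<And>j. j \<in> S \<Longrightarrow> (\<alpha> + 4) / lam * sqrt (real s) * \<tau> < \<bar>bs j\<bar>"
    and score: "\<And>j. j \<in> {1..p} \<Longrightarrow> \<bar>loss_grad n p x y bs j\<bar> \<le> c / 5 * \<tau>"
    and small: "real s * \<nu>\<^sup>2 * \<gamma> * \<tau> \<le> 2 * c ^ 3 / 125" "real s * \<nu>\<^sup>2 * \<gamma> * \<tau> \<le> 3 * c\<^sup>2 / 20"
    and argmin: "is_arg_min (\<lambda>b. logistic_loss n p x y b + \<tau> * l1_norm p b) (\<lambda>_. True) bh"
  shows "supp_vec p bh = S"
proof -
  have \<delta>: "0 < c / 5" "4 * (c / 5) < \<alpha>" and lam: "0 < lam"
    using c by auto
  have \<gamma>_bound: "\<bar>x i j\<bar> \<le> \<gamma>" if "i \<in> {1..n}" "j \<in> {1..p}" for i j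
  proof -
    have "\<bar>x i j\<bar> \<le> linf_norm p (x i)"
      unfolding linf_norm_def using that by (intro Max_ge) auto
    also have "\<dots> \<le> \<gamma>"
      unfolding \<gamma> max_linf_def using that by (intro Max_ge) auto
    finally show ?thesis .
  qed
  show ?thesis
  proof (cases "S = {}")
    case True
    \<comment> \<open>The prescribed radius may be \<open>0\<close> here, but on an empty support any positive radius will do.\<close>
    show ?thesis
      by (rule logistic_lasso_support[where r = 1 and \<nu> = 0, OF n y S \<tau> lam \<delta> c(4) _ _ \<gamma>_bound psd irrep score _ _ _ _ argmin])
        (use True \<delta> \<tau> lam in auto)
  next
    case False
    have SP: "S \<subseteq> {1..p}" and finS: "finite S"
      using S by (auto simp: supp_vec_def)
    have s1: "1 \<le> real s"
      using False finS s card_gt_0_iff[of S] by linarith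
    define r where "r = (\<alpha> + 4) / lam * sqrt (real s) * \<tau>"
    have r: "0 < r"
      using c lam s1 \<tau> by (simp add: r_def)
    have \<nu>_bound: "L2_set (x i) S \<le> \<nu>" if "i \<in> {1..n}" for i
      unfolding \<nu> max_l2_on_def using that by (intro Max_ge) auto
    have \<nu>_nonneg: "0 \<le> \<nu>"
      using order_trans[OF L2_set_nonneg \<nu>_bound[of 1]] n by simp
    have \<gamma>_nonneg: "0 \<le> \<gamma>"
    proof -
      obtain j where "j \<in> {1..p}"
        using False SP by blast
      then show ?thesis
        using order_trans[OF abs_ge_zero \<gamma>_bound[of 1 j]] n by simp
    qed
    have "\<nu> \<le> sqrt (real s) * \<gamma>"
    proof -
      have "L2_set (x i) S \<le> sqrt (real s) * \<gamma>" if i: "i \<in> {1..n}" for i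
      proof -
        have "L2_set (x i) S = L2_set (\<lambda>j. \<bar>x i j\<bar>) S"
          by (simp add: L2_set_def)
        also have "\<dots> \<le> L2_set (\<lambda>_. \<gamma>) S"
          using \<gamma>_bound[OF i] SP by (intro L2_set_mono) auto
        also have "\<dots> = sqrt (real (card S)) * \<gamma>"
          using \<gamma>_nonneg by (simp add: L2_set_constant)
        also have "\<dots> \<le> sqrt (real s) * \<gamma>"
          using s \<gamma>_nonneg by (intro mult_right_mono) auto
        finally show ?thesis .
      qed
      then show ?thesis
        unfolding \<nu> max_l2_on_def using n by (subst Max_le_iff) auto
    qed
    have r_le: "r \<le> 5 / c * (sqrt (real s) * \<tau>)"
    proof -
      have "(\<alpha> + 4) / lam \<le> 5 / c"
        using c by (intro frac_le) auto
      then show ?thesis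
        unfolding r_def mult.assoc using \<tau> by (intro mult_right_mono) auto
    qed
    have remainder: "\<gamma> * (\<nu> * r)\<^sup>2 / 2 \<le> c / 5 * \<tau>"
    proof -
      have "r\<^sup>2 \<le> (5 / c * (sqrt (real s) * \<tau>))\<^sup>2"
        using r r_le by (intro power_mono) auto
      also have "\<dots> = 25 / c\<^sup>2 * real s * \<tau>\<^sup>2"
        using s1 by (simp add: power_mult_distrib power_divide)
      finally have "\<gamma> * \<nu>\<^sup>2 * r\<^sup>2 \<le> \<gamma> * \<nu>\<^sup>2 * (25 / c\<^sup>2 * real s * \<tau>\<^sup>2)"
        using \<gamma>_nonneg by (intro mult_left_mono) auto
      also have "\<dots> = 25 / c\<^sup>2 * \<tau> * (real s * \<nu>\<^sup>2 * \<gamma> * \<tau>)"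
        by (simp add: power2_eq_square)
      also have "\<dots> \<le> 25 / c\<^sup>2 * \<tau> * (2 * c ^ 3 / 125)"
        using small(1) \<tau> by (intro mult_left_mono) auto
      also have "\<dots> = 2 * (c / 5 * \<tau>)"
        using c by (simp add: power2_eq_square power3_eq_cube)
      finally show ?thesis
        by (simp add: power_mult_distrib mult.assoc)
    qed
    have cubic: "(\<nu> * r) ^ 3 / 6 \<le> lam * r\<^sup>2 / 8"
    proof -
      have "\<nu> ^ 3 * r = \<nu>\<^sup>2 * (\<nu> * r)"
        by (simp add: power2_eq_square power3_eq_cube)
      also have "\<dots> \<le> \<nu>\<^sup>2 * ((sqrt (real s) * \<gamma>) * (5 / c * (sqrt (real s) * \<tau>)))"
        using \<open>\<nu> \<le> sqrt (real s) * \<gamma>\<close> r_le r \<gamma>_nonneg by (intro mult_left_mono mult_mono) auto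
      also have "\<dots> = 5 / c * ((sqrt (real s))\<^sup>2 * \<nu>\<^sup>2 * \<gamma> * \<tau>)"
        by (simp add: power2_eq_square)
      also have "\<dots> \<le> 5 / c * (3 * c\<^sup>2 / 20)"
        using small(2) c by (intro mult_left_mono) auto
      also have "\<dots> = 3 / 4 * c"
        using c by (simp add: power2_eq_square)
      finally have "\<nu> ^ 3 * r \<le> 3 / 4 * lam"
        using c by linarith
      then have "\<nu> ^ 3 * r * r\<^sup>2 \<le> 3 / 4 * lam * r\<^sup>2"
        by (intro mult_right_mono) auto
      then show ?thesis
        by (simp add: power_mult_distrib power2_eq_square power3_eq_cube mult_ac)
    qed
    have radius: "(1 + c / 5) * \<tau> * sqrt (real (card S)) < 3 / 8 * lam * r"
    proof -
      have "(1 + c / 5) * \<tau> * sqrt (real (card S)) \<le> (1 + c / 5) * \<tau> * sqrt (real s)"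
        using c \<tau> s by (intro mult_left_mono) auto
      also have "\<dots> < 3 / 8 * (\<alpha> + 4) * \<tau> * sqrt (real s)"
        using c \<tau> s1 by (intro mult_strict_right_mono) auto
      also have "\<dots> = 3 / 8 * lam * r"
        using lam by (simp add: r_def)
      finally show ?thesis .
    qed
    show ?thesis
      by (rule logistic_lasso_support[OF n y S \<tau> lam \<delta> c(4) r \<nu>_bound \<gamma>_bound psd irrep score
            _ remainder cubic radius argmin]) (use signal in \<open>auto simp: r_def\<close>)
  qed
qed

section \<open>Concentration of the score\<close>

lemma (in prob_space)
  fixes Y :: "'a \<Rightarrow> real"
  assumes Y [measurable]: "random_variable borel Y"
    and one: "prob {\<omega> \<in> space M. Y \<omega> = 1} = q"
    and zero: "1 - prob {\<omega> \<in> space M. Y \<omega> = 0} = q"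
  shows AE_bernoulli: "AE \<omega> in M. Y \<omega> \<in> {0, 1}"
    and expectation_bernoulli: "expectation Y = q"
proof -
  let ?A = "{\<omega> \<in> space M. Y \<omega> = 1}" and ?B = "{\<omega> \<in> space M. Y \<omega> = 0}"
  have "prob (?A \<union> ?B) = prob ?A + prob ?B"
    by (rule finite_measure_Union) auto
  then have "prob (?A \<union> ?B) = 1"
    using one zero by simp
  then have "AE \<omega> in M. \<omega> \<in> ?A \<union> ?B"
    by (rule AE_prob_1)
  then show AE: "AE \<omega> in M. Y \<omega> \<in> {0, 1}"
    by eventually_elim auto
  have "expectation Y = expectation (indicator ?A)"
    by (rule integral_cong_AE) (use AE in \<open>auto elim!: eventually_mono split: split_indicator\<close>)
  then show "expectation Y = q"
    using one by simp
qed

text \<open>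
  Hoeffding's inequality, where the range of the \<open>i\<close>-th summand has width \<open>\<bar>u i\<bar>\<close>.  If all weights
  vanish, Hoeffding's inequality in the form used is void, but the sum is then identically zero.
\<close>

lemma (in prob_space) bernoulli_weighted_sum_tail:
  fixes Y :: "nat \<Rightarrow> 'a \<Rightarrow> real" and u q :: "nat \<Rightarrow> real"
  assumes n: "n \<ge> 1" and indep: "indep_vars (\<lambda>_. borel) Y {1..n}"
    and one: "\<And>i. i \<in> {1..n} \<Longrightarrow> prob {\<omega> \<in> space M. Y i \<omega> = 1} = q i"
    and zero: "\<And>i. i \<in> {1..n} \<Longrightarrow> 1 - prob {\<omega> \<in> space M. Y i \<omega> = 0} = q i"
    and u: "(\<Sum>i = 1..n. (u i)\<^sup>2) \<le> real n" and t: "0 < t"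
  shows "prob {\<omega> \<in> space M. t \<le> \<bar>(1 / real n) * (\<Sum>i = 1..n. u i * (q i - Y i \<omega>))\<bar>}
    \<le> 2 * exp (- 2 * real n * t\<^sup>2)"
proof (cases "(\<Sum>i = 1..n. (u i)\<^sup>2) = 0")
  case True
  then have "u i = 0" if "i \<in> {1..n}" for i
    using that by (simp add: sum_nonneg_eq_0_iff)
  then have "(\<Sum>i = 1..n. u i * (q i - Y i \<omega>)) = 0" for \<omega>
    by (intro sum.neutral) auto
  then have "{\<omega> \<in> space M. t \<le> \<bar>(1 / real n) * (\<Sum>i = 1..n. u i * (q i - Y i \<omega>))\<bar>} = {}"
    using t by (simp only: mult_zero_right) auto
  then show ?thesis
    by (simp only: measure_empty) simp
next
  case False
  let ?D = "\<Sum>i = 1..n. (u i)\<^sup>2"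
  have D: "0 < ?D"
    using False sum_nonneg[of "{1..n}" "\<lambda>i. (u i)\<^sup>2"] by simp
  have rv: "random_variable borel (Y i)" if "i \<in> {1..n}" for i
    using indep that by (auto simp: indep_vars_def)
  interpret Hoeffding_ineq M "{1..n}" "\<lambda>i \<omega>. u i * Y i \<omega>" "\<lambda>i. min 0 (u i)" "\<lambda>i. max 0 (u i)"
    "\<Sum>i = 1..n. expectation (\<lambda>\<omega>. u i * Y i \<omega>)"
  proof unfold_locales
    show "indep_vars (\<lambda>_. borel) (\<lambda>i \<omega>. u i * Y i \<omega>) {1..n}"
      by (rule indep_vars_compose2[OF indep]) auto
    show "AE \<omega> in M. u i * Y i \<omega> \<in> {min 0 (u i)..max 0 (u i)}" if "i \<in> {1..n}" for i
      using AE_bernoulli[OF rv[OF that] one[OF that] zero[OF that]] by eventually_elim auto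
  qed auto
  have mean: "(\<Sum>i = 1..n. expectation (\<lambda>\<omega>. u i * Y i \<omega>)) = (\<Sum>i = 1..n. u i * q i)"
    using expectation_bernoulli[OF rv one zero] by (intro sum.cong) auto
  have width: "(\<Sum>i = 1..n. (max 0 (u i) - min 0 (u i))\<^sup>2) = ?D"
    by (intro sum.cong) (auto simp: max_def min_def)
  have "{\<omega> \<in> space M. t \<le> \<bar>(1 / real n) * (\<Sum>i = 1..n. u i * (q i - Y i \<omega>))\<bar>}
      = {\<omega> \<in> space M. real n * t \<le> \<bar>(\<Sum>i = 1..n. u i * Y i \<omega>) - (\<Sum>i = 1..n. expectation (\<lambda>\<omega>. u i * Y i \<omega>))\<bar>}"
    unfolding mean using n
    by (simp add: right_diff_distrib sum_subtractf abs_minus_commute abs_mult field_simps)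
  then have "prob {\<omega> \<in> space M. t \<le> \<bar>(1 / real n) * (\<Sum>i = 1..n. u i * (q i - Y i \<omega>))\<bar>}
      \<le> 2 * exp (- 2 * (real n * t)\<^sup>2 / ?D)"
    using Hoeffding_ineq_abs_ge[of "real n * t"] D t unfolding width by simp
  also have "\<dots> \<le> 2 * exp (- 2 * real n * t\<^sup>2)"
  proof -
    have "2 * real n * t\<^sup>2 = 2 * (real n * t)\<^sup>2 / real n"
      using n by (simp add: power2_eq_square)
    also have "\<dots> \<le> 2 * (real n * t)\<^sup>2 / ?D"
      using D u n by (intro divide_left_mono) auto
    finally show ?thesis by simp
  qed
  finally show ?thesis .
qed

text \<open>
  Union bound over the \<open>p\<close> coordinates of the score, in a form that handles an arbitrary event \<open>bad\<close>:
  it suffices that no outcome with labels in \<open>{0, 1}\<close> and small score is bad.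
\<close>

lemma (in prob_space) logistic_score_tail:
  fixes Y :: "nat \<Rightarrow> 'a \<Rightarrow> real" and x :: "nat \<Rightarrow> nat \<Rightarrow> real"
  assumes n: "n \<ge> 1" and indep: "indep_vars (\<lambda>_. borel) Y {1..n}"
    and one: "\<And>i. i \<in> {1..n} \<Longrightarrow> prob {\<omega> \<in> space M. Y i \<omega> = 1} = sigmoid (inner_vec p (x i) bs)"
    and zero: "\<And>i. i \<in> {1..n} \<Longrightarrow> 1 - prob {\<omega> \<in> space M. Y i \<omega> = 0} = sigmoid (inner_vec p (x i) bs)"
    and design: "\<And>j. j \<in> {1..p} \<Longrightarrow> (\<Sum>i = 1..n. (x i j)\<^sup>2) \<le> real n" and t: "0 < t"
    and good: "\<And>\<omega>. \<omega> \<in> space M \<Longrightarrow> (\<lambda>i. Y i \<omega>) \<in> {1..n} \<rightarrow> {0, 1} \<Longrightarrow>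
      (\<And>j. j \<in> {1..p} \<Longrightarrow> \<bar>loss_grad n p x (\<lambda>i. Y i \<omega>) bs j\<bar> \<le> t) \<Longrightarrow> \<not> bad \<omega>"
  shows "prob {\<omega> \<in> space M. bad \<omega>} \<le> 2 * real p * exp (- 2 * real n * t\<^sup>2)"
proof -
  let ?E = "\<lambda>j. {\<omega> \<in> space M. t \<le> \<bar>loss_grad n p x (\<lambda>i. Y i \<omega>) bs j\<bar>}"
  have rv: "random_variable borel (Y i)" if "i \<in> {1..n}" for i
    using indep that by (auto simp: indep_vars_def)
  have grad_rv: "random_variable borel (\<lambda>\<omega>. loss_grad n p x (\<lambda>i. Y i \<omega>) bs j)" for j
    unfolding loss_grad_def by (intro borel_measurable_times borel_measurable_sum borel_measurable_diff rv) auto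
  have E: "?E j \<in> events" for j
    using grad_rv[of j] by measurable
  have "AE \<omega> in M. \<forall>i\<in>{1..n}. Y i \<omega> \<in> {0, 1}"
    using AE_bernoulli[OF rv one zero] by (intro AE_finite_allI) auto
  then have "AE \<omega> in M. \<omega> \<in> {\<omega> \<in> space M. bad \<omega>} \<longrightarrow> \<omega> \<in> (\<Union>j\<in>{1..p}. ?E j)"
  proof eventually_elim
    case (elim \<omega>)
    show ?case
    proof (intro impI, rule ccontr)
      assume bad: "\<omega> \<in> {\<omega> \<in> space M. bad \<omega>}" and "\<omega> \<notin> (\<Union>j\<in>{1..p}. ?E j)"
      then have "\<bar>loss_grad n p x (\<lambda>i. Y i \<omega>) bs j\<bar> \<le> t" if "j \<in> {1..p}" for j
        using that by fastforce
      moreover have "(\<lambda>i. Y i \<omega>) \<in> {1..n} \<rightarrow> {0, 1}"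
        using elim by blast
      ultimately show False
        using good[of \<omega>] bad by blast
    qed
  qed
  then have "prob {\<omega> \<in> space M. bad \<omega>} \<le> prob (\<Union>j\<in>{1..p}. ?E j)"
    using E by (intro finite_measure_mono_AE) auto
  also have "\<dots> \<le> (\<Sum>j = 1..p. prob (?E j))"
    using E by (intro finite_measure_subadditive_finite) auto
  also have "\<dots> \<le> (\<Sum>j = 1..p. 2 * exp (- 2 * real n * t\<^sup>2))"
    unfolding loss_grad_def by (intro sum_mono bernoulli_weighted_sum_tail n indep one zero design t)
  finally show ?thesis
    by simp
qed

text \<open>
  The factor \<open>p\<close> of the union bound uses up at most half of the exponent.  The other half is bounded using
  \<open>ln p \<ge> ln 2\<close>, so that the result does not involve \<open>p\<close> and vanishes as \<open>u\<close> grows, even when \<open>p\<close>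
  stays bounded.
\<close>

lemma union_bound_exponential:
  assumes p: "p \<ge> (2 :: nat)" and u: "1 \<le> u"
  shows "real p * exp (- (2 * u * ln (real p))) \<le> 1 / (u * ln 2)"
proof -
  have "real p * exp (- (2 * u * ln (real p))) = exp (ln (real p) * (1 - 2 * u))"
    using p by (simp add: exp_diff exp_minus right_diff_distrib field_simps)
  also have "\<dots> \<le> exp (- (u * ln 2))"
  proof -
    have "u * ln 2 \<le> u * ln (real p)"
      using p u by (intro mult_left_mono) auto
    moreover have "ln (real p) * 1 \<le> ln (real p) * u"
      using p u by (intro mult_left_mono) auto
    ultimately show ?thesis
      by (simp add: algebra_simps)
  qed
  also have "\<dots> \<le> 1 / (u * ln 2)"
  proof -
    have "0 < u * ln 2" "u * ln 2 \<le> exp (u * ln 2)"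
      using u less_imp_le[OF exp_gt_self] by auto
    then show ?thesis
      by (simp add: exp_minus inverse_eq_divide frac_le)
  qed
  finally show ?thesis .
qed

section \<open>Sparsistency\<close>

theorem corollary6p2:
  fixes M :: "nat \<Rightarrow> 'a measure"
    and p s :: "nat \<Rightarrow> nat"
    and \<beta>s :: "nat \<Rightarrow> nat \<Rightarrow> real"
    and S :: "nat \<Rightarrow> nat set"
    and x :: "nat \<Rightarrow> nat \<Rightarrow> nat \<Rightarrow> real"
    and Y :: "nat \<Rightarrow> nat \<Rightarrow> 'a \<Rightarrow> real"
    and \<beta>hat :: "nat \<Rightarrow> 'a \<Rightarrow> nat \<Rightarrow> real"
    and \<tau> \<nu> \<gamma> lam \<alpha> :: "nat \<Rightarrow> real"
    and c :: real
  assumes prob: "\<And>n. n \<ge> 1 \<Longrightarrow> prob_space (M n)"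
    and dim: "\<And>n. n \<ge> 1 \<Longrightarrow> p n \<ge> 2"
    and support: "\<And>n. n \<ge> 1 \<Longrightarrow> S n = supp_vec (p n) (\<beta>s n)"
    and sparsity: "\<And>n. n \<ge> 1 \<Longrightarrow> card (S n) \<le> s n"
    and design: "\<And>n j. n \<ge> 1 \<Longrightarrow> j \<in> {1..p n} \<Longrightarrow> (\<Sum>i = 1..n. (x n i j)\<^sup>2) \<le> real n"
    and indep: "\<And>n. n \<ge> 1 \<Longrightarrow> prob_space.indep_vars (M n) (\<lambda>_. borel) (Y n) {1..n}"
    and Y_one: "\<And>n i. n \<ge> 1 \<Longrightarrow> i \<in> {1..n} \<Longrightarrow>
      measure (M n) {\<omega> \<in> space (M n). Y n i \<omega> = 1}
        = 1 / (1 + exp (- inner_vec (p n) (x n i) (\<beta>s n)))"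
    and Y_zero: "\<And>n i. n \<ge> 1 \<Longrightarrow> i \<in> {1..n} \<Longrightarrow>
      1 - measure (M n) {\<omega> \<in> space (M n). Y n i \<omega> = 0}
        = 1 / (1 + exp (- inner_vec (p n) (x n i) (\<beta>s n)))"
    and tau_pos: "\<And>n. n \<ge> 1 \<Longrightarrow> \<tau> n > 0"
    and estimator: "\<And>n \<omega>. n \<ge> 1 \<Longrightarrow> \<omega> \<in> space (M n) \<Longrightarrow>
      is_arg_min (\<lambda>\<beta>. logistic_loss n (p n) (x n) (\<lambda>i. Y n i \<omega>) \<beta> + \<tau> n * l1_norm (p n) \<beta>)
        (\<lambda>_. True) (\<beta>hat n \<omega>)"
    and estimator_measurable: "\<And>n j. n \<ge> 1 \<Longrightarrow> j \<in> {1..p n} \<Longrightarrow>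
      (\<lambda>\<omega>. \<beta>hat n \<omega> j) \<in> borel_measurable (M n)"
    and nu: "\<And>n. n \<ge> 1 \<Longrightarrow> \<nu> n = max_l2_on n (S n) (x n)"
    and gamma: "\<And>n. n \<ge> 1 \<Longrightarrow> \<gamma> n = max_linf n (p n) (x n)"
    and bounded_away: "c > 0" "\<And>n. n \<ge> 1 \<Longrightarrow> lam n \<ge> c" "\<And>n. n \<ge> 1 \<Longrightarrow> \<alpha> n \<ge> c"
    and alpha_le_1: "\<And>n. n \<ge> 1 \<Longrightarrow> \<alpha> n \<le> 1"
    and i: "\<And>n y. n \<ge> 1 \<Longrightarrow> y \<in> {1..n} \<rightarrow> {0, 1} \<Longrightarrow>
      loewner_ge (S n) (hessian (logistic_loss n (p n) (x n) y) (\<beta>s n))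
        (\<lambda>j k. lam n * id_mat j k)"
    and ii: "\<And>n y. n \<ge> 1 \<Longrightarrow> y \<in> {1..n} \<rightarrow> {0, 1} \<Longrightarrow>
      linf_op_norm ({1..p n} - S n) (S n)
        (mult_mat (S n) (hessian (logistic_loss n (p n) (x n) y) (\<beta>s n))
          (inv_mat (S n) (hessian (logistic_loss n (p n) (x n) y) (\<beta>s n)))) < 1 - \<alpha> n"
    and iii: "\<And>n k. n \<ge> 1 \<Longrightarrow> k \<in> S n \<Longrightarrow>
      \<bar>\<beta>s n k\<bar> > (\<alpha> n + 4) / lam n * sqrt (real (s n)) * \<tau> n"
    and tau_lower: "(\<lambda>n. sqrt (ln (real (p n)) / real n)) \<lless> \<tau>"
    and tau_upper: "\<tau> \<lless> (\<lambda>n. 1 / (real (s n) * (\<nu> n)\<^sup>2 * \<gamma> n))"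
    and growth: "(\<lambda>n. (real (s n))\<^sup>2 * ln (real (p n)) * (\<nu> n) ^ 4 * (\<gamma> n)\<^sup>2) \<lless> (\<lambda>n. real n)"
  shows "(\<lambda>n. measure (M n) {\<omega> \<in> space (M n).
           supp_vec (p n) (\<beta>hat n \<omega>) \<noteq> supp_vec (p n) (\<beta>s n)}) \<longlonglongrightarrow> 0"
proof -
  \<comment> \<open>\<open>q\<close> governs the tail probability of the score, \<open>T\<close> the two Taylor errors.\<close>
  define q where "q n = sqrt (ln (real (p n)) / real n) / \<tau> n" for n
  define T where "T n = real (s n) * (\<nu> n)\<^sup>2 * \<gamma> n * \<tau> n" for n
  let ?bad = "\<lambda>n \<omega>. supp_vec (p n) (\<beta>hat n \<omega>) \<noteq> supp_vec (p n) (\<beta>s n)"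
  have q: "q \<longlonglongrightarrow> 0"
    using tau_lower by (simp add: much_less_def q_def[abs_def])
  have "T \<longlonglongrightarrow> 0"
    using tau_upper by (simp add: much_less_def T_def[abs_def] mult_ac)
  then have "eventually (\<lambda>n. T n < min (2 * c ^ 3 / 125) (3 * c\<^sup>2 / 20)) sequentially"
    using bounded_away(1) by (intro order_tendstoD(2)) auto
  moreover have "eventually (\<lambda>n. q n < c / 5) sequentially"
    using q bounded_away(1) by (intro order_tendstoD(2)) auto
  ultimately have upper: "eventually (\<lambda>n. measure (M n) {\<omega> \<in> space (M n). ?bad n \<omega>}
      \<le> 2 * ((q n)\<^sup>2 / ((c / 5)\<^sup>2 * ln 2))) sequentially"
    using eventually_ge_at_top[of 1]
  proof eventually_elim
    case (elim n)
    then have n: "1 \<le> n" by simp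
    interpret prob_space "M n"
      by (rule prob[OF n])
    have t: "0 < c / 5 * \<tau> n"
      using bounded_away(1) tau_pos[OF n] by simp
    have one: "prob {\<omega> \<in> space (M n). Y n i \<omega> = 1} = sigmoid (inner_vec (p n) (x n i) (\<beta>s n))"
      and zero: "1 - prob {\<omega> \<in> space (M n). Y n i \<omega> = 0} = sigmoid (inner_vec (p n) (x n i) (\<beta>s n))"
      if "i \<in> {1..n}" for i
      using Y_one[OF n that] Y_zero[OF n that] by (simp_all add: sigmoid_def)
    have "prob {\<omega> \<in> space (M n). ?bad n \<omega>} \<le> 2 * real (p n) * exp (- 2 * real n * (c / 5 * \<tau> n)\<^sup>2)"
    proof (rule logistic_score_tail[OF n indep[OF n] one zero design[OF n] t])
      fix \<omega>
      assume \<omega>: "\<omega> \<in> space (M n)" and y: "(\<lambda>i. Y n i \<omega>) \<in> {1..n} \<rightarrow> {0, 1}"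
        and score: "\<And>j. j \<in> {1..p n} \<Longrightarrow> \<bar>loss_grad n (p n) (x n) (\<lambda>i. Y n i \<omega>) (\<beta>s n) j\<bar> \<le> c / 5 * \<tau> n"
      have "supp_vec (p n) (\<beta>hat n \<omega>) = S n"
        using elim bounded_away
        by (intro logistic_lasso_support_rate[OF n y support[OF n] sparsity[OF n] tau_pos[OF n] _ _ _
              alpha_le_1[OF n] nu[OF n] gamma[OF n] i[OF n y] ii[OF n y] iii[OF n] score _ _
              estimator[OF n \<omega>]]) (auto simp: T_def)
      then show "\<not> ?bad n \<omega>"
        by (simp add: support[OF n])
    qed auto
    also have "\<dots> = 2 * (real (p n) * exp (- (2 * ((c / 5)\<^sup>2 / (q n)\<^sup>2) * ln (real (p n)))))"
    proof -
      have "0 < ln (real (p n))"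
        using dim[OF n] by simp
      then have "real n * (\<tau> n)\<^sup>2 = ln (real (p n)) / (q n)\<^sup>2"
        using n tau_pos[OF n] by (simp add: q_def power_divide)
      then have "2 * (c / 5)\<^sup>2 * (real n * (\<tau> n)\<^sup>2) = 2 * (c / 5)\<^sup>2 * (ln (real (p n)) / (q n)\<^sup>2)"
        by (rule arg_cong)
      then have "2 * real n * (c / 5 * \<tau> n)\<^sup>2 = 2 * ((c / 5)\<^sup>2 / (q n)\<^sup>2) * ln (real (p n))"
        by (simp add: power_mult_distrib power_divide mult_ac)
      then show ?thesis by simp
    qed
    also have "\<dots> \<le> 2 * (1 / ((c / 5)\<^sup>2 / (q n)\<^sup>2 * ln 2))"
    proof (intro mult_left_mono union_bound_exponential dim[OF n])
      have "0 < q n"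
        using dim[OF n] n tau_pos[OF n] by (simp add: q_def)
      then show "1 \<le> (c / 5)\<^sup>2 / (q n)\<^sup>2"
        using elim power_mono[of "q n" "c / 5" 2] by simp
    qed simp
    finally show ?case
      by simp
  qed
  have "(\<lambda>n. 2 * ((q n)\<^sup>2 / ((c / 5)\<^sup>2 * ln 2))) \<longlonglongrightarrow> 2 * (0\<^sup>2 / ((c / 5)\<^sup>2 * ln 2))"
    using bounded_away(1) by (intro tendsto_intros q) auto
  then have "(\<lambda>n. 2 * ((q n)\<^sup>2 / ((c / 5)\<^sup>2 * ln 2))) \<longlonglongrightarrow> 0"
    by simp
  from tendsto_sandwich[OF _ upper tendsto_const this] show ?thesis
    by simp
qed

end
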